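(* Let $A=\operatorname{Re}m_\infty(i)$, $B=-\operatorname{Im}m_\infty(i)$, $m=m_\infty(-0)$. Among all Schrödinger L-systems $\Theta_{\mu,h}$ ($\operatorname{Im}h>0$, $\mu\in\mathbb R\cup\{\infty\}$) whose main operator $T_h$ is accretive, the maximum finite c-entropy $\mathcal S_{max}$ is achieved by an L-system $\Theta_{\mu,h}$ with extremal accretive main operator. In this case $$\mathcal S_{max}=-\frac12\ln\left(\frac{\sqrt{A^2+B^2-2mA+m^2}-B}{\sqrt{A^2+B^2-2mA+m^2}+B}\right)$$ and $\Theta_{\mu,h}$ is determined by the parameters $$h=-m+i\sqrt{(A-m)^2+B^2}\quad\text{and (arbitrary)}\quad\mu\in\mathbb R\cup\{\infty\}.$$
   Context: Setting. Let $\ell\in\mathbb R$, let $q$ be a (fixed) real locally summable function on $[\ell,+\infty)$, $l(y)=-y''+q(x)y$, $\mathcal H=L_2(\ell,+\infty)$. Let $D^*$ be the set of $y\in\mathcal H$ that are locally absolutely continuous together with $y'$ and satisfy $l(y)\in\mathcal H$. The minimal symmetric operator $\dot A y=l(y)$ with boundary conditions $y(\ell)=y'(\ell)=0$ is assumed to have deficiency indices $(1,1)$; $\operatorname{Dom}(\dot A^* )=D^*$, $\dot A^*y=l(y)$. For $h\in\mathbb C$ with $\operatorname{Im}h>0$, $T_h y=l(y)$ with domain $\{y\in D^*: y'(\ell)=hy(\ell)\}$. Weyl function. Let $\varphi_1,\varphi_2$ solve $l(\varphi_k)=\lambda\varphi_k$ with $\varphi_1(\ell,\lambda)=0,\varphi_1'(\ell,\lambda)=1$,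 $\varphi_2(\ell,\lambda)=-1,\varphi_2'(\ell,\lambda)=0$. The Weyl function $m_\infty(\lambda)$ is such that $\varphi_2(\cdot,\lambda)+m_\infty(\lambda)\varphi_1(\cdot,\lambda)\in L_2(\ell,+\infty)$. One has $\operatorname{Im}m_\infty(i)<0$. Standing assumptions: $\dot A$ is nonnegative, $(\dot Af,f)\ge0$ for $f\in\operatorname{Dom}(\dot A)$, and $m_\infty(-0):=\lim_{\lambda\to0,\lambda<0}m_\infty(\lambda)<\infty$. Schrödinger L-systems. $\mathcal H_+=D^*$ with $(y,z)_+=\int_\ell^\infty (y\bar z+l(y)\overline{l(z)})dx$, and $\mathcal H_+\subset\mathcal H\subset\mathcal H_-$ is the corresponding rigged triplet; $\delta(x-\ell),\delta'(x-\ell)\in\mathcal H_-$ act by $(y,\delta)=y(\ell)$, $(y,\delta')=-y'(\ell)$. For $\mu\in\mathbb R\cup\{\infty\}$ put $\mathbb A_{\mu,h}y=-y''+q y-\frac1{\mu-h}[y'(\ell)-hy(\ell)][\mu\delta(x-\ell)+\delta'(x-\ell)]$ and $g=\frac{(\operatorname{Im}h)^{1/2}}{|\mu-h|}[\mu\delta(x-\ell)+\delta'(x-\ell)]$ (limits as $\mu\to\infty$ if $\mu=\infty$), $Kc=cg$ for $c\in\mathbb C$; then $\operatorname{Im}\mathbb A_{\mu,h}=KK^*$. The array $\Theta_{\mu,h}=(\mathbb A_{\mu,h},K,1;\ \mathcal H_+\subset\mathcal H\subset\mathcal H_-,\mathbb C)$ is the Schrödinger L-system with main operator $T_h$ and state-space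 operator $\mathbb A_{\mu,h}$. Its transfer function is $W_{\Theta_{\mu,h}}(z)=I-2iK^*(\mathbb A_{\mu,h}-zI)^{-1}K=\frac{\mu-h}{\mu-\bar h}\cdot\frac{m_\infty(z)+\bar h}{m_\infty(z)+h}$ (limit as $\mu\to\infty$ if $\mu=\infty$). The c-entropy of $\Theta_{\mu,h}$ is $\mathcal S=-\ln|W_{\Theta_{\mu,h}}(-i)|$; it equals $-\ln|\kappa|$ where $|\kappa|=\left|\frac{m_\infty(i)+h}{m_\infty(i)+\bar h}\right|<1$ is the modulus of von Neumann's parameter of $T_h$. Accretivity. A linear operator $T$ is accretive if $\operatorname{Re}(Tf,f)\ge0$ for all $f\in\operatorname{Dom}(T)$; it is $\alpha$-sectorial, $\alpha\in(0,\pi/2)$, if $(\cot\alpha)|\operatorname{Im}(Tf,f)|\le\operatorname{Re}(Tf,f)$ for all $f\in\operatorname{Dom}(T)$; an accretive operator is extremal (extremal accretive) if it is not $\alpha$-sectorial for any $\alpha\in(0,\pi/2)$. *)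

theory Defs
  imports "HOL-Analysis.Analysis" "HOL-Library.Function_Algebras"
begin

text \<open>
  The half-line is \<open>{l..}\<close>, the Hilbert space is the space of complex square-integrable functions
  on it. Its elements are represented by functions on the real line, and only the values on
  \<open>{l..}\<close>, up to null sets, are relevant.
\<close>

definition L2 :: "real \<Rightarrow> (real \<Rightarrow> complex) set" where
  "L2 l = {f. f \<in> borel_measurable (lebesgue_on {l..}) \<and>
              integrable (lebesgue_on {l..}) (\<lambda>x. (cmod (f x))\<^sup>2)}"

definition L2_inner :: "real \<Rightarrow> (real \<Rightarrow> complex) \<Rightarrow> (real \<Rightarrow> complex) \<Rightarrow> complex" where
  "L2_inner l f g = (\<integral>x. f x * cnj (g x) \<partial>(lebesgue_on {l..}))"

definition locally_summable :: "real \<Rightarrow> (real \<Rightarrow> real) \<Rightarrow> bool" where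
  "locally_summable l q \<longleftrightarrow> (\<forall>b. q absolutely_integrable_on {l..b})"

text \<open>Local absolute continuity: being an indefinite Lebesgue integral on every compact interval.\<close>

definition locally_AC :: "real \<Rightarrow> (real \<Rightarrow> complex) \<Rightarrow> bool" where
  "locally_AC l f \<longleftrightarrow>
     (\<exists>d. \<forall>b\<ge>l. d absolutely_integrable_on {l..b} \<and> f b = f l + integral {l..b} d)"

text \<open>The derivative on the half-line; it is one-sided at the end point \<open>l\<close>.\<close>

definition D :: "real \<Rightarrow> (real \<Rightarrow> complex) \<Rightarrow> real \<Rightarrow> complex" where
  "D l y x = vector_derivative y (at x within {l..})"

definition twice_AC :: "real \<Rightarrow> (real \<Rightarrow> complex) \<Rightarrow> bool" where
  "twice_AC l y \<longleftrightarrow>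
     (\<forall>x\<ge>l. (y has_vector_derivative D l y x) (at x within {l..})) \<and>
     locally_AC l y \<and> locally_AC l (D l y)"

text \<open>The expression \<open>-y'' + q y\<close>; for \<open>y\<close> as above, \<open>y''\<close> exists almost everywhere.\<close>

definition schr :: "(real \<Rightarrow> real) \<Rightarrow> real \<Rightarrow> (real \<Rightarrow> complex) \<Rightarrow> real \<Rightarrow> complex" where
  "schr q l y x = - D l (D l y) x + complex_of_real (q x) * y x"

text \<open>
  The set \<open>D\<^sup>*\<close>, which is also the space \<open>\<H>\<^sub>+\<close>. Functions are extended by zero to the left of
  \<open>l\<close>, so that distinct members are distinct elements of the function space on \<open>{l..}\<close>.
\<close>

definition D_star :: "(real \<Rightarrow> real) \<Rightarrow> real \<Rightarrow> (real \<Rightarrow> complex) set" where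
  "D_star q l = {y \<in> L2 l. (\<forall>x<l. y x = 0) \<and> twice_AC l y \<and> schr q l y \<in> L2 l}"

definition dom_min :: "(real \<Rightarrow> real) \<Rightarrow> real \<Rightarrow> (real \<Rightarrow> complex) set" where
  "dom_min q l = {y \<in> D_star q l. y l = 0 \<and> D l y l = 0}"

definition dom_T :: "(real \<Rightarrow> real) \<Rightarrow> real \<Rightarrow> complex \<Rightarrow> (real \<Rightarrow> complex) set" where
  "dom_T q l h = {y \<in> D_star q l. D l y l = h * y l}"

text \<open>
  The kernel of \<open>A\<^sup>* - z\<close>, where \<open>A\<^sup>*\<close>, the adjoint of the minimal operator, acts as
  \<open>schr q l\<close> on \<open>D_star q l\<close>.
\<close>

definition deficiency_space :: "(real \<Rightarrow> real) \<Rightarrow> real \<Rightarrow> complex \<Rightarrow> (real \<Rightarrow> complex) set" where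
  "deficiency_space q l z =
     {y \<in> D_star q l. AE x in lebesgue_on {l..}. schr q l y x = z * y x}"

definition deficiency_index :: "(real \<Rightarrow> real) \<Rightarrow> real \<Rightarrow> complex \<Rightarrow> nat" where
  "deficiency_index q l z =
     vector_space.dim (\<lambda>(c::complex) y x. c * y x) (deficiency_space q l z)"

text \<open>Linear operators in the Hilbert space are given by a domain \<open>S\<close> and an action \<open>T\<close> on it.\<close>

definition nonnegative_op ::
  "real \<Rightarrow> (real \<Rightarrow> complex) set \<Rightarrow> ((real \<Rightarrow> complex) \<Rightarrow> real \<Rightarrow> complex) \<Rightarrow> bool" where
  "nonnegative_op l S T \<longleftrightarrow> (\<forall>f\<in>S. L2_inner l (T f) f \<in> \<real>\<^sub>\<ge>\<^sub>0)"

definition accretive ::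
  "real \<Rightarrow> (real \<Rightarrow> complex) set \<Rightarrow> ((real \<Rightarrow> complex) \<Rightarrow> real \<Rightarrow> complex) \<Rightarrow> bool" where
  "accretive l S T \<longleftrightarrow> (\<forall>f\<in>S. 0 \<le> Re (L2_inner l (T f) f))"

definition sectorial ::
  "real \<Rightarrow> real \<Rightarrow> (real \<Rightarrow> complex) set \<Rightarrow> ((real \<Rightarrow> complex) \<Rightarrow> real \<Rightarrow> complex) \<Rightarrow> bool" where
  "sectorial l \<alpha> S T \<longleftrightarrow>
     (\<forall>f\<in>S. cot \<alpha> * \<bar>Im (L2_inner l (T f) f)\<bar> \<le> Re (L2_inner l (T f) f))"

definition extremal_accretive ::
  "real \<Rightarrow> (real \<Rightarrow> complex) set \<Rightarrow> ((real \<Rightarrow> complex) \<Rightarrow> real \<Rightarrow> complex) \<Rightarrow> bool" where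
  "extremal_accretive l S T \<longleftrightarrow>
     accretive l S T \<and> \<not> (\<exists>\<alpha>. 0 < \<alpha> \<and> \<alpha> < pi / 2 \<and> sectorial l \<alpha> S T)"

definition is_solution ::
  "(real \<Rightarrow> real) \<Rightarrow> real \<Rightarrow> complex \<Rightarrow> (real \<Rightarrow> complex) \<Rightarrow> bool" where
  "is_solution q l z \<phi> \<longleftrightarrow>
     twice_AC l \<phi> \<and> (AE x in lebesgue_on {l..}. schr q l \<phi> x = z * \<phi> x)"

text \<open>
  The Weyl function of a nonnegative minimal operator lives off the half-axis \<open>[0, \<infinity>)\<close>; the values
  of \<open>M\<close> on that half-axis are irrelevant.
\<close>

definition weyl_function :: "(real \<Rightarrow> real) \<Rightarrow> real \<Rightarrow> (complex \<Rightarrow> complex) \<Rightarrow> bool" where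
  "weyl_function q l M \<longleftrightarrow>
     (\<forall>z. z \<notin> \<real>\<^sub>\<ge>\<^sub>0 \<longrightarrow>
        (\<exists>\<phi>1 \<phi>2. is_solution q l z \<phi>1 \<and> \<phi>1 l = 0 \<and> D l \<phi>1 l = 1 \<and>
                 is_solution q l z \<phi>2 \<and> \<phi>2 l = -1 \<and> D l \<phi>2 l = 0 \<and>
                 (\<lambda>x. \<phi>2 x + M z * \<phi>1 x) \<in> L2 l))"

text \<open>
  An element \<open>F\<close> of \<open>\<H>\<^sub>-\<close> is represented by the antilinear functional \<open>v \<mapsto> (F, v)\<close> on \<open>\<H>\<^sub>+\<close>.
  Hence \<open>\<delta>\<close> and \<open>\<delta>'\<close>, which are given by \<open>(y, \<delta>) = y l\<close> and \<open>(y, \<delta>') = - y' l\<close>, act with a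
  complex conjugation. The parameter \<open>\<mu>\<close> is \<open>None\<close> for \<open>\<mu> = \<infinity>\<close>, where the formulas are the
  limits for \<open>\<mu> \<rightarrow> +\<infinity>\<close>. All functionals are restricted to \<open>\<H>\<^sub>+\<close>, so that equality of
  functionals is equality in \<open>\<H>\<^sub>-\<close>.
\<close>

type_synonym functional = "(real \<Rightarrow> complex) \<Rightarrow> complex"

definition delta :: "real \<Rightarrow> functional" where
  "delta l v = cnj (v l)"

definition delta' :: "real \<Rightarrow> functional" where
  "delta' l v = - cnj (D l v l)"

definition state_op ::
  "(real \<Rightarrow> real) \<Rightarrow> real \<Rightarrow> real option \<Rightarrow> complex \<Rightarrow> (real \<Rightarrow> complex) \<Rightarrow> functional" where
  "state_op q l \<mu> h y = (\<lambda>v\<in>D_star q l. L2_inner l (schr q l y) v -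
     (case \<mu> of
        Some m \<Rightarrow> 1 / (complex_of_real m - h) * (D l y l - h * y l) *
                  (complex_of_real m * delta l v + delta' l v)
      | None \<Rightarrow> (D l y l - h * y l) * delta l v))"

definition channel_vec ::
  "(real \<Rightarrow> real) \<Rightarrow> real \<Rightarrow> real option \<Rightarrow> complex \<Rightarrow> functional" where
  "channel_vec q l \<mu> h = (\<lambda>v\<in>D_star q l.
     (case \<mu> of
        Some m \<Rightarrow> complex_of_real (sqrt (Im h) / cmod (complex_of_real m - h)) *
                  (complex_of_real m * delta l v + delta' l v)
      | None \<Rightarrow> complex_of_real (sqrt (Im h)) * delta l v))"

definition K_op ::
  "(real \<Rightarrow> real) \<Rightarrow> real \<Rightarrow> real option \<Rightarrow> complex \<Rightarrow> complex \<Rightarrow> functional" where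
  "K_op q l \<mu> h c = (\<lambda>v\<in>D_star q l. c * channel_vec q l \<mu> h v)"

text \<open>The adjoint of \<open>K\<close> from \<open>\<H>\<^sub>+\<close> to the complex numbers: \<open>K\<^sup>* y = (y, g)\<close>.\<close>

definition K_adj ::
  "(real \<Rightarrow> real) \<Rightarrow> real \<Rightarrow> real option \<Rightarrow> complex \<Rightarrow> (real \<Rightarrow> complex) \<Rightarrow> complex" where
  "K_adj q l \<mu> h y = cnj (channel_vec q l \<mu> h y)"

text \<open>\<open>(\<A>\<^sub>\<mu>\<^sub>,\<^sub>h - z I)\<^sup>-\<^sup>1\<close>, the inverse of an operator from \<open>\<H>\<^sub>+\<close> into \<open>\<H>\<^sub>-\<close>.\<close>

definition state_resolvent ::
  "(real \<Rightarrow> real) \<Rightarrow> real \<Rightarrow> real option \<Rightarrow> complex \<Rightarrow> complex \<Rightarrow> functional \<Rightarrow> real \<Rightarrow> complex" where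
  "state_resolvent q l \<mu> h z =
     inv_into (D_star q l) (\<lambda>y. \<lambda>v\<in>D_star q l. state_op q l \<mu> h y v - z * L2_inner l y v)"

text \<open>The transfer function acts on the one-dimensional space of complex numbers; this is the
  scalar by which it multiplies.\<close>

definition transfer_function ::
  "(real \<Rightarrow> real) \<Rightarrow> real \<Rightarrow> real option \<Rightarrow> complex \<Rightarrow> complex \<Rightarrow> complex" where
  "transfer_function q l \<mu> h z =
     1 - 2 * \<i> * K_adj q l \<mu> h (state_resolvent q l \<mu> h z (K_op q l \<mu> h 1))"

text \<open>The c-entropy is infinite when the transfer function vanishes at \<open>-\<i>\<close> (recall that
  \<open>ln 0 = 0\<close> in HOL).\<close>

definition c_entropy :: "(real \<Rightarrow> real) \<Rightarrow> real \<Rightarrow> real option \<Rightarrow> complex \<Rightarrow> ereal" where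
  "c_entropy q l \<mu> h =
     (let W = transfer_function q l \<mu> h (- \<i>) in if W = 0 then \<infinity> else ereal (- ln (cmod W)))"

end

theory Submission
  imports Defs
begin

text \<open>
  Let \<open>(y, z)\<close> denote the inner product on the half-line, and consider on \<open>D\<^sup>*\<close> the form
  \<open>Q(y, z) = (l(y), z) - y'(l) cnj (z(l))\<close>, which is \<open>boundary_form\<close> below; formally \<open>Q(y, y)\<close> is
  the energy integral of \<open>\<bar>y'\<bar>\<^sup>2 + q \<bar>y\<bar>\<^sup>2\<close>. On the domain of \<open>T\<^sub>h\<close> it gives
  \<open>(T\<^sub>h y, y) = Q(y, y) + h \<bar>y(l)\<bar>\<^sup>2\<close>. Accretivity and extremality of \<open>T\<^sub>h\<close> are therefore questions
  about the infimum of \<open>Q(y, y)\<close> under the constraint \<open>\<bar>y(l)\<bar> = 1\<close>. This infimum is \<open>m = M(-0)\<close>, and it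
  stays the same when \<open>y'(l)\<close> is prescribed as well.

  The form \<open>Q\<close> is hermitian by Green's formula (\<open>green\<close>). The boundary term at infinity in
  that formula only sees the functions near infinity, so they may be replaced by members of the minimal
  domain; there \<open>(l(f), f)\<close> is real, and polarization makes the boundary term vanish.
  The slope \<open>y'(l)\<close> does not influence the infimum because there are functions with value \<open>0\<close> and slope \<open>1\<close> at \<open>l\<close> that
  live so close to \<open>l\<close> that their norm and their energy are arbitrarily small
  (\<open>concentrated_functions\<close>). In particular \<open>Q(v, v) \<ge> 0\<close> not only on the minimal domain but whenever
  \<open>v(l) = 0\<close>. Now let \<open>\<psi>\<close> be the Weyl solution at \<open>t < 0\<close>, with \<open>\<psi>(l) = -1\<close> and \<open>\<psi>'(l) = M(t)\<close>. If
  \<open>\<bar>y(l)\<bar> = 1\<close>, comparison of \<open>y\<close> with a multiple of \<open>\<psi>\<close> gives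
  \<open>Q(y, y) \<ge> M(t) + t \<parallel>y\<parallel>\<^sup>2\<close>, and \<open>t \<rightarrow> 0\<close> shows \<open>Q(y, y) \<ge> m\<close>. Conversely \<open>Q(\<psi>, \<psi>) \<le> M(t)\<close>, and a
  multiple of a concentrated function moves \<open>\<psi>\<close> into the domain of \<open>T\<^sub>h\<close> at an arbitrarily small
  cost in energy. Hence \<open>T\<^sub>h\<close> is
  accretive exactly for \<open>Re h \<ge> -m\<close> (\<open>accretive_iff\<close>), and on the boundary \<open>Re h = -m\<close> of this half-plane
  it is extremal (\<open>extremal_boundary\<close>), since \<open>Re (T\<^sub>h y, y)\<close> comes arbitrarily close to \<open>0\<close> while
  \<open>Im (T\<^sub>h y, y) = Im h\<close>.

  The resolvent in the transfer function at \<open>-\<i>\<close> is a multiple of the Weyl solution at \<open>-\<i>\<close>, so that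
  \<open>\<bar>W(-\<i>)\<bar> = \<bar>cnj (M \<i>) + cnj h\<bar> / \<bar>cnj (M \<i>) + h\<bar>\<close> for every \<open>\<mu>\<close> (\<open>cmod_transfer_function\<close>). With
  \<open>s = A + Re h\<close> and \<open>y = Im h\<close> its square is \<open>(s\<^sup>2 + (B - y)\<^sup>2) / (s\<^sup>2 + (B + y)\<^sup>2)\<close>, to be minimized over
  \<open>s \<ge> A - m\<close>, \<open>y > 0\<close>; the minimum is attained only at \<open>s = A - m\<close>, \<open>y = sqrt ((A - m)\<^sup>2 + B\<^sup>2)\<close>
  (\<open>ratio_minimum\<close>). That it is positive, which makes the maximal entropy finite, rests on the strict inequalities \<open>B > 0\<close>
  and \<open>A > m\<close> (\<open>M_Im_neg\<close>, \<open>limit_less_Re_M\<close>). The first holds because \<open>B\<close> is the squared norm of the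
  Weyl solution at \<open>\<i>\<close>. As for the second, \<open>A\<close> is the energy \<open>Q\<close> of that solution, so \<open>A \<ge> m\<close>; and a
  minimizer of the energy would be orthogonal to the minimal domain, which the Weyl solution is not.

  The differential expression is built from pointwise derivatives, while absolute continuity only
  provides a density. The two agree almost everywhere by Lebesgue's differentiation theorem, with which
  the proof starts.
\<close>

section \<open>Lebesgue's differentiation theorem on a half-line\<close>

lemma AE_lebesgue_on_negligible:
  assumes "negligible N" and "S \<in> sets lebesgue" and "\<And>x. x \<in> S \<Longrightarrow> x \<notin> N \<Longrightarrow> P x"
  shows "AE x in lebesgue_on S. P x"
proof -
  have "AE x in lebesgue. x \<notin> N"
    using assms(1) by (simp add: AE_not_in negligible_iff_null_sets)
  then have "AE x in lebesgue. x \<in> S \<longrightarrow> P x"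
    by eventually_elim (use assms(3) in auto)
  then show ?thesis
    using assms(2) by (simp add: AE_restrict_space_iff)
qed

lemma vector_derivative_atI_onesided:
  fixes F :: "real \<Rightarrow> 'a :: real_normed_vector"
  assumes right: "\<And>e. e > 0 \<Longrightarrow> \<exists>d>0. \<forall>k. 0 < k \<and> k < d \<longrightarrow> norm ((F (x + k) - F x) /\<^sub>R k - v) < e"
    and left: "\<And>e. e > 0 \<Longrightarrow> \<exists>d>0. \<forall>k. 0 < k \<and> k < d \<longrightarrow> norm ((F x - F (x - k)) /\<^sub>R k - v) < e"
  shows "(F has_vector_derivative v) (at x)"
proof -
  have "((\<lambda>k. (F (x + k) - F x) /\<^sub>R k - v) \<longlongrightarrow> 0) (at 0)"
  proof (rule LIM_I)
    fix e :: real assume e: "0 < e"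
    obtain d1 where d1: "d1 > 0" "\<And>k. 0 < k \<Longrightarrow> k < d1 \<Longrightarrow> norm ((F (x + k) - F x) /\<^sub>R k - v) < e"
      using right[OF e] by blast
    obtain d2 where d2: "d2 > 0" "\<And>k. 0 < k \<Longrightarrow> k < d2 \<Longrightarrow> norm ((F x - F (x - k)) /\<^sub>R k - v) < e"
      using left[OF e] by blast
    have "norm ((F (x + k) - F x) /\<^sub>R k - v) < e" if "k \<noteq> 0" "\<bar>k\<bar> < min d1 d2" for k
    proof (cases "k > 0")
      case True
      with d1(2)[of k] that show ?thesis by simp
    next
      case False
      have "(F (x + k) - F x) /\<^sub>R k = (F x - F (x - (-k))) /\<^sub>R (-k)"
        by (simp add: scaleR_diff_right)
      with d2(2)[of "-k"] that False show ?thesis by simp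
    qed
    then show "\<exists>s>0. \<forall>k. k \<noteq> 0 \<and> norm (k - 0) < s \<longrightarrow> norm ((F (x + k) - F x) /\<^sub>R k - v - 0) < e"
      using d1(1) d2(1) by (intro exI[of _ "min d1 d2"]) auto
  qed
  then have "((\<lambda>k. ((F (x + k) - F x) /\<^sub>R k - v)) \<longlongrightarrow> 0) (at 0)" .
  moreover have "norm (((F (x + k) - F x) /\<^sub>R k - v)) = norm ((F (x + k) - F x - k *\<^sub>R v)) / norm k"
    if "k \<noteq> 0" for k
  proof -
    have "(F (x + k) - F x) /\<^sub>R k - v = (F (x + k) - F x - k *\<^sub>R v) /\<^sub>R k"
      using that by (simp add: scaleR_diff_right)
    then show ?thesis by (simp add: divide_inverse mult.commute)
  qed
  ultimately have "((\<lambda>k. norm (F (x + k) - F x - k *\<^sub>R v) / norm k) \<longlongrightarrow> 0) (at 0)"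
    by (subst (asm) tendsto_norm_zero_iff[symmetric], subst (asm) filterlim_cong[OF refl refl])
       (auto simp: eventually_at_filter)
  then show ?thesis
    unfolding has_vector_derivative_def has_derivative_at
    by (auto intro!: bounded_linear_intros)
qed

text \<open>
  Almost everywhere convergence of the averages over intervals \<open>[x, x + h]\<close> is
  \<open>integrable_ccontinuous_explicit\<close> in dimension one. Applied to the reflected function it yields the averages over
  \<open>[x - h, x]\<close>, and hence the two-sided derivative.
\<close>

lemma lebesgue_differentiation:
  fixes f :: "real \<Rightarrow> 'a :: euclidean_space"
  assumes f: "\<And>b. f absolutely_integrable_on {l..b}"
  shows "AE x in lebesgue_on {l..}.
           ((\<lambda>x. integral {l..x} f) has_vector_derivative f x) (at x within {l..})"
proof -
  define g where "g = (\<lambda>x. if x \<in> {l..} then f x else 0)"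
  have int_g: "g integrable_on {a..b}" for a b
  proof -
    have "{l..} \<inter> {a..b} = {max l a..b}" by auto
    moreover have "f integrable_on {max l a..b}"
      by (rule integrable_on_subinterval[of _ "{l..b}"])
         (use f[of b] in \<open>auto simp: set_lebesgue_integral_eq_integral(1)\<close>)
    ultimately show ?thesis
      unfolding g_def by (simp only: Henstock_Kurzweil_Integration.integrable_restrict_Int)
  qed
  have int_gm: "(\<lambda>x. g (- x)) integrable_on {a..b}" for a b
    using int_g[of "-b" "-a"]
      Henstock_Kurzweil_Integration.integrable_reflect_real[where f = g and a = "-b" and b = "-a"]
    by simp
  obtain N where N: "negligible N"
    "\<And>x e. \<lbrakk>x \<notin> N; 0 < e\<rbrakk> \<Longrightarrow> \<exists>d>0. \<forall>h. 0 < h \<and> h < d \<longrightarrow>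
         norm (integral (cbox x (x + h *\<^sub>R One)) g /\<^sub>R h ^ DIM(real) - g x) < e"
    using integrable_ccontinuous_explicit[of g] int_g by (auto simp: cbox_interval)
  obtain N' where N': "negligible N'"
    "\<And>x e. \<lbrakk>x \<notin> N'; 0 < e\<rbrakk> \<Longrightarrow> \<exists>d>0. \<forall>h. 0 < h \<and> h < d \<longrightarrow>
         norm (integral (cbox x (x + h *\<^sub>R One)) (\<lambda>x. g (- x)) /\<^sub>R h ^ DIM(real) - g (- x)) < e"
    using integrable_ccontinuous_explicit[of "\<lambda>x. g (- x)"] int_gm by (auto simp: cbox_interval)
  have "negligible (uminus ` N')"
    using N'(1) by (intro negligible_differentiable_image_negligible derivative_intros) auto
  then have neg: "negligible (N \<union> uminus ` N' \<union> {l})"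
    using N(1) by auto
  show ?thesis
  proof (rule AE_lebesgue_on_negligible[OF neg])
    fix x assume "x \<in> {l..}" and xN: "x \<notin> N \<union> uminus ` N' \<union> {l}"
    then have x: "l < x" by auto
    have xN': "- x \<notin> N'" using xN by force
    define F where "F = (\<lambda>x. integral {l..x} g)"
    have F_diff: "F t - F s = integral {s..t} g" if "l \<le> s" "s \<le> t" for s t
      using Henstock_Kurzweil_Integration.integral_combine[of l s t g] that int_g
      by (simp add: F_def diff_eq_eq add.commute)
    have "(F has_vector_derivative g x) (at x)"
    proof (rule vector_derivative_atI_onesided)
      fix e :: real assume e: "e > 0"
      obtain d where "d > 0" "\<And>h. 0 < h \<Longrightarrow> h < d \<Longrightarrow> norm (integral {x..x + h} g /\<^sub>R h - g x) < e"
        using N(2)[of x e] xN e by (auto simp: cbox_interval)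
      then show "\<exists>d>0. \<forall>k. 0 < k \<and> k < d \<longrightarrow> norm ((F (x + k) - F x) /\<^sub>R k - g x) < e"
        using x F_diff[of x "x + _"] by (intro exI[of _ d]) simp
    next
      fix e :: real assume e: "e > 0"
      obtain d where d: "d > 0" "\<And>h. 0 < h \<Longrightarrow> h < d \<Longrightarrow>
          norm (integral {-x..-x + h} (\<lambda>x. g (- x)) /\<^sub>R h - g x) < e"
        using N'(2)[of "- x" e] xN' e by (auto simp: cbox_interval)
      have "integral {-x..-x + h} (\<lambda>x. g (- x)) = integral {x - h..x} g" for h
        using Henstock_Kurzweil_Integration.integral_reflect_real[where f = g and a = "x - h" and b = x]
        by (simp add: add.commute)
      then show "\<exists>d>0. \<forall>k. 0 < k \<and> k < d \<longrightarrow> norm ((F x - F (x - k)) /\<^sub>R k - g x) < e"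
        using d x F_diff[of "x - _" x] by (intro exI[of _ "min d (x - l)"]) auto
    qed
    moreover have "F = (\<lambda>x. integral {l..x} f)"
      unfolding F_def g_def by (intro ext Henstock_Kurzweil_Integration.integral_cong) auto
    moreover have "g x = f x" using x by (simp add: g_def)
    ultimately show "((\<lambda>x. integral {l..x} f) has_vector_derivative f x) (at x within {l..})"
      using has_vector_derivative_at_within by auto
  qed simp
qed

section \<open>Absolutely continuous functions\<close>

text \<open>
  Local absolute continuity with a named density, so that densities can be computed with.
\<close>

definition primitive_of :: "real \<Rightarrow> (real \<Rightarrow> complex) \<Rightarrow> (real \<Rightarrow> complex) \<Rightarrow> bool" where
  "primitive_of l f d \<longleftrightarrow>
     (\<forall>b\<ge>l. d absolutely_integrable_on {l..b} \<and> f b = f l + integral {l..b} d)"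

lemma locally_AC_iff: "locally_AC l f \<longleftrightarrow> (\<exists>d. primitive_of l f d)"
  by (simp add: locally_AC_def primitive_of_def)

lemma primitive_of_eq:
  assumes "primitive_of l f d" "l \<le> b"
  shows "f b = f l + integral {l..b} d"
  using assms unfolding primitive_of_def by blast

lemma primitive_of_abs_integrable:
  assumes "primitive_of l f d"
  shows "d absolutely_integrable_on {l..b}"
proof (cases "l \<le> b")
  case True
  then show ?thesis using assms unfolding primitive_of_def by blast
qed simp

lemma primitive_of_abs_integrable':
  assumes "primitive_of l f d" "l \<le> a"
  shows "d absolutely_integrable_on {a..b}"
  by (rule absolutely_integrable_on_subinterval[OF primitive_of_abs_integrable[OF assms(1), of b]])
     (use assms in auto)

lemma primitive_of_diff:
  assumes "primitive_of l f d" "l \<le> s" "s \<le> t"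
  shows "f t - f s = integral {s..t} d"
proof -
  have "d integrable_on {l..t}"
    by (intro set_lebesgue_integral_eq_integral(1) primitive_of_abs_integrable[OF assms(1)])
  then have "integral {l..s} d + integral {s..t} d = integral {l..t} d"
    using assms by (intro Henstock_Kurzweil_Integration.integral_combine) auto
  moreover have "f t = f l + integral {l..t} d" "f s = f l + integral {l..s} d"
    using assms by (auto intro!: primitive_of_eq)
  ultimately show ?thesis by (simp add: diff_eq_eq add.commute)
qed

lemma primitive_of_continuous_on:
  assumes "primitive_of l f d"
  shows "continuous_on {l..b} f"
proof -
  have "continuous_on {l..b} (\<lambda>x. f l + integral {l..x} d)"
    by (intro continuous_intros indefinite_integral_continuous_1 set_lebesgue_integral_eq_integral(1)
         primitive_of_abs_integrable[OF assms])
  moreover have "f x = f l + integral {l..x} d" if "x \<in> {l..b}" for x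
    using assms that by (auto intro!: primitive_of_eq)
  ultimately show ?thesis by (metis (no_types, lifting) continuous_on_cong)
qed

lemma continuous_on_half_lineI:
  fixes f :: "real \<Rightarrow> 'a :: topological_space"
  assumes "\<And>b. continuous_on {l..b} f"
  shows "continuous_on {l..} f"
proof -
  have "continuous (at x within {l..}) f" if "x \<in> {l..}" for x
  proof -
    have "continuous (at x within {l..x+1}) f"
      using assms[of "x+1"] that by (simp add: continuous_on_eq_continuous_within)
    moreover have "at x within {l..} = at x within {l..x+1}"
      by (rule at_within_nhd[of x "{..<x+1}"]) auto
    ultimately show ?thesis by simp
  qed
  then show ?thesis by (simp add: continuous_on_eq_continuous_within)
qed

lemma primitive_of_AE_derivative:
  assumes "primitive_of l f d"
  shows "AE x in lebesgue_on {l..}. (f has_vector_derivative d x) (at x within {l..})"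
proof -
  have "AE x in lebesgue_on {l..}.
          ((\<lambda>x. integral {l..x} d) has_vector_derivative d x) (at x within {l..})"
    using assms by (intro lebesgue_differentiation primitive_of_abs_integrable)
  moreover have "AE x in lebesgue_on {l..}. x \<in> {l..}"
    using AE_space[of "lebesgue_on {l..}"] by simp
  ultimately show ?thesis
  proof eventually_elim
    case (elim x)
    have "((\<lambda>x. f l + integral {l..x} d) has_vector_derivative d x) (at x within {l..})"
      using has_vector_derivative_add[OF has_vector_derivative_const[of "f l"] elim(1)] by simp
    then show ?case
      by (rule has_vector_derivative_transform[rotated 2])
         (use assms elim in \<open>auto intro!: primitive_of_eq\<close>)
  qed
qed

lemma primitive_of_C1:
  assumes "\<And>x. x \<ge> l \<Longrightarrow> (g has_vector_derivative g' x) (at x within {l..})"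
    and "continuous_on {l..} g'"
  shows "primitive_of l g g'"
  unfolding primitive_of_def
proof (intro allI impI conjI)
  fix b assume b: "l \<le> b"
  have "continuous_on {l..b} g'" using assms(2) by (rule continuous_on_subset) auto
  then show "g' absolutely_integrable_on {l..b}"
    by (rule absolutely_integrable_continuous_real)
  have "(g' has_integral g b - g l) {l..b}"
    using b assms(1) by (intro fundamental_theorem_of_calculus)
      (auto intro: has_vector_derivative_within_subset[where S = "{l..}"])
  then show "g b = g l + integral {l..b} g'" by (simp add: integral_unique)
qed

lemma has_vector_derivative_imp_continuous_on:
  assumes "\<And>x. x \<in> S \<Longrightarrow> (g has_vector_derivative g' x) (at x within S)"
  shows "continuous_on S g"
  using assms has_vector_derivative_continuous continuous_on_eq_continuous_within by blast

lemma abs_integrable_mult_continuous: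
  fixes d g :: "real \<Rightarrow> complex"
  assumes "d absolutely_integrable_on {a..b}" "continuous_on {a..b} g"
  shows "(\<lambda>x. d x * g x) absolutely_integrable_on {a..b}"
proof -
  have "(\<lambda>x. g x * d x) absolutely_integrable_on {a..b}"
  proof (rule absolutely_integrable_bounded_measurable_product[OF bilinear_times])
    show "g \<in> borel_measurable (lebesgue_on {a..b})"
      using assms(2) by (simp add: continuous_imp_measurable_on_sets_lebesgue)
    show "bounded (g ` {a..b})"
      using assms(2) by (simp add: compact_continuous_image compact_imp_bounded)
  qed (use assms in auto)
  then show ?thesis by (simp add: mult.commute)
qed

text \<open>
  Let \<open>P\<close> be the product minus the integral of the expected density. On \<open>[s, t]\<close> the functions \<open>g\<close> and
  \<open>f\<close> vary by at most \<open>K (t - s)\<close> and \<open>V t - V s\<close>, where \<open>V\<close> is the integral of \<open>\<bar>d\<bar>\<close>, so \<open>P\<close> changes by at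
  most \<open>2 K (t - s) (V t - V s)\<close>. As \<open>V\<close> is continuous, \<open>P\<close> has derivative \<open>0\<close> everywhere and is constant.
\<close>

lemma primitive_of_mult_C1:
  assumes f: "primitive_of l f d"
    and g: "\<And>x. x \<ge> l \<Longrightarrow> (g has_vector_derivative g' x) (at x within {l..})"
    and g': "continuous_on {l..} g'"
  shows "primitive_of l (\<lambda>x. f x * g x) (\<lambda>x. d x * g x + f x * g' x)"
  unfolding primitive_of_def
proof (intro allI impI)
  fix b assume b: "l \<le> b"
  let ?p = "\<lambda>x. d x * g x + f x * g' x"
  have gc: "continuous_on {l..} g"
    using g by (intro has_vector_derivative_imp_continuous_on[of _ g g']) auto
  note cont = continuous_on_subset[OF gc] continuous_on_subset[OF g']
  have fc: "continuous_on {l..b} f" using f by (rule primitive_of_continuous_on)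
  have dg: "(\<lambda>x. d x * g x) absolutely_integrable_on {l..b}"
    by (intro abs_integrable_mult_continuous primitive_of_abs_integrable[OF f] cont) auto
  have fg: "(\<lambda>x. f x * g' x) absolutely_integrable_on {l..b}"
    by (intro absolutely_integrable_continuous_real continuous_intros fc cont) auto
  have p: "?p absolutely_integrable_on {l..b}"
    using dg fg by (rule set_integral_add(1))
  have p_int: "?p integrable_on {s..t}" if "l \<le> s" "t \<le> b" for s t
    by (rule integrable_on_subinterval[OF set_lebesgue_integral_eq_integral(1)[OF p]]) (use that in auto)
  have nd_int: "(\<lambda>x. norm (d x)) integrable_on {s..t}" if "l \<le> s" "t \<le> b" for s t
    using primitive_of_abs_integrable'[OF f that(1)] by (simp add: absolutely_integrable_on_def)
  define V where "V = (\<lambda>x. integral {l..x} (\<lambda>x. norm (d x)))"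
  have V_diff: "V t - V s = integral {s..t} (\<lambda>x. norm (d x))" if "l \<le> s" "s \<le> t" "t \<le> b" for s t
    using Henstock_Kurzweil_Integration.integral_combine[of l s t "\<lambda>x. norm (d x)"] that nd_int
    by (simp add: V_def diff_eq_eq add.commute)
  have V_cont: "continuous_on {l..b} V"
    unfolding V_def by (intro indefinite_integral_continuous_1 nd_int) auto
  have "bounded (g' ` {l..b})"
    by (intro compact_imp_bounded compact_continuous_image cont) auto
  then obtain K where K: "K > 0" "\<And>x. x \<in> {l..b} \<Longrightarrow> norm (g' x) \<le> K"
    by (auto simp: bounded_pos)
  have g_prim: "primitive_of l g g'" using g g' by (rule primitive_of_C1)
  have g_lip: "norm (g t - g s) \<le> K * (t - s)" if "l \<le> s" "s \<le> t" "t \<le> b" for s t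
  proof -
    have "norm (integral {s..t} g') \<le> integral {s..t} (\<lambda>x. K)"
      by (rule Henstock_Kurzweil_Integration.integral_norm_bound_integral)
         (use that K set_lebesgue_integral_eq_integral(1)[OF primitive_of_abs_integrable'[OF g_prim that(1)]] in auto)
    then show ?thesis using primitive_of_diff[OF g_prim that(1,2)] that by (simp add: mult.commute)
  qed
  have f_var: "norm (f t - f s) \<le> V t - V s" if "l \<le> s" "s \<le> t" "t \<le> b" for s t
  proof -
    have "norm (integral {s..t} d) \<le> integral {s..t} (\<lambda>x. norm (d x))"
      by (rule Henstock_Kurzweil_Integration.integral_norm_bound_integral)
         (use that nd_int set_lebesgue_integral_eq_integral(1)[OF primitive_of_abs_integrable'[OF f that(1)]] in auto)
    then show ?thesis using primitive_of_diff[OF f that(1,2)] V_diff[OF that] by simp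
  qed
  have V_mono: "V s \<le> V t" if "l \<le> s" "s \<le> t" "t \<le> b" for s t
    using f_var[OF that] norm_ge_zero[of "f t - f s"] by linarith
  define P where "P = (\<lambda>x. f x * g x - integral {l..x} ?p)"
  have P_bound: "norm (P t - P s) \<le> 2 * K * (t - s) * (V t - V s)"
    if st: "l \<le> s" "s \<le> t" "t \<le> b" for s t
  proof -
    have int1: "d integrable_on {s..t}" "g' integrable_on {s..t}"
      using set_lebesgue_integral_eq_integral(1)[OF primitive_of_abs_integrable'[OF f st(1)]]
        set_lebesgue_integral_eq_integral(1)[OF primitive_of_abs_integrable'[OF g_prim st(1)]] by auto
    have "f t * g t - f s * g s = (f t - f s) * g t + f s * (g t - g s)"
      by (simp add: algebra_simps)
    also have "\<dots> = integral {s..t} d * g t + f s * integral {s..t} g'"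
      using primitive_of_diff[OF f st(1,2)] primitive_of_diff[OF g_prim st(1,2)] by simp
    also have "\<dots> = integral {s..t} (\<lambda>x. d x * g t + f s * g' x)"
      using int1 by (subst Henstock_Kurzweil_Integration.integral_add)
        (auto intro: integrable_on_mult_left integrable_on_mult_right)
    finally have 1: "f t * g t - f s * g s = integral {s..t} (\<lambda>x. d x * g t + f s * g' x)" .
    have int2: "(\<lambda>x. d x * g t + f s * g' x) integrable_on {s..t}"
      using int1 by (intro Henstock_Kurzweil_Integration.integrable_add integrable_on_mult_left integrable_on_mult_right)
    have "P t - P s = f t * g t - f s * g s - integral {s..t} ?p"
      using Henstock_Kurzweil_Integration.integral_combine[of l s t ?p] st p_int
      by (simp add: P_def algebra_simps)
    also have "\<dots> = integral {s..t} (\<lambda>x. (d x * g t + f s * g' x) - ?p x)"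
      unfolding 1 using int2 p_int st by (subst Henstock_Kurzweil_Integration.integral_diff) auto
    finally have 2: "P t - P s = integral {s..t} (\<lambda>x. (d x * g t + f s * g' x) - ?p x)" .
    have "norm (P t - P s) \<le> integral {s..t} (\<lambda>x. norm (d x) * (K * (t - s)) + (V t - V s) * K)"
      unfolding 2
    proof (rule Henstock_Kurzweil_Integration.integral_norm_bound_integral)
      show "(\<lambda>x. (d x * g t + f s * g' x) - ?p x) integrable_on {s..t}"
        using int2 p_int st by (intro Henstock_Kurzweil_Integration.integrable_diff) auto
      show "(\<lambda>x. norm (d x) * (K * (t - s)) + (V t - V s) * K) integrable_on {s..t}"
        using nd_int st by (intro Henstock_Kurzweil_Integration.integrable_add integrable_on_mult_left) auto
      fix x assume x: "x \<in> {s..t}"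
      have "(d x * g t + f s * g' x) - ?p x = d x * (g t - g x) - (f x - f s) * g' x"
        by (simp add: algebra_simps)
      also have "norm \<dots> \<le> norm (d x) * norm (g t - g x) + norm (f x - f s) * norm (g' x)"
        using norm_triangle_ineq4 by (metis norm_mult)
      also have "\<dots> \<le> norm (d x) * (K * (t - s)) + (V t - V s) * K"
      proof (intro add_mono mult_mono)
        show "norm (g t - g x) \<le> K * (t - s)"
          using x st K(1) by (intro order_trans[OF g_lip] mult_left_mono) auto
        show "norm (f x - f s) \<le> V t - V s"
          using f_var[of s x] V_mono[of x t] x st by auto
      qed (use K x st V_mono[of s t] in auto)
      finally show "norm ((d x * g t + f s * g' x) - ?p x) \<le>
        norm (d x) * (K * (t - s)) + (V t - V s) * K" .
    qed
    also have "\<dots> = (V t - V s) * (K * (t - s)) + (V t - V s) * K * (t - s)"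
      using nd_int st V_diff[OF st]
      by (subst Henstock_Kurzweil_Integration.integral_add) (auto intro: integrable_on_mult_left)
    finally show ?thesis by (simp add: algebra_simps)
  qed
  have P_bound': "norm (P t - P s) \<le> 2 * K * \<bar>V t - V s\<bar> * \<bar>t - s\<bar>" if "s \<in> {l..b}" "t \<in> {l..b}" for s t
    using P_bound[of s t] P_bound[of t s] V_mono[of s t] V_mono[of t s] that
    by (cases "s \<le> t") (auto simp: norm_minus_commute algebra_simps)
  have "(P has_derivative (\<lambda>h. 0)) (at x within {l..b})" if x: "x \<in> {l..b}" for x
    unfolding has_derivative_within
  proof (intro conjI bounded_linear_zero)
    have "((\<lambda>y. 2 * K * \<bar>V y - V x\<bar>) \<longlongrightarrow> 2 * K * \<bar>V x - V x\<bar>) (at x within {l..b})"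
      using V_cont x by (intro tendsto_intros) (auto simp: continuous_on)
    then have "((\<lambda>y. 2 * K * \<bar>V y - V x\<bar>) \<longlongrightarrow> 0) (at x within {l..b})" by simp
    then show "((\<lambda>y. (1 / norm (y - x)) *\<^sub>R (P y - (P x + 0))) \<longlongrightarrow> 0) (at x within {l..b})"
    proof (rule Lim_null_comparison[rotated])
      show "\<forall>\<^sub>F y in at x within {l..b}.
              norm ((1 / norm (y - x)) *\<^sub>R (P y - (P x + 0))) \<le> 2 * K * \<bar>V y - V x\<bar>"
        unfolding eventually_at_filter
        using P_bound'[OF x] by (intro always_eventually) (auto simp: divide_le_eq)
    qed
  qed
  then have "P b = P l"
    using b by (intro has_derivative_zero_unique[of "{l..b}"]) auto
  then show "?p absolutely_integrable_on {l..b} \<and> f b * g b = f l * g l + integral {l..b} ?p"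
    using p by (simp add: P_def diff_eq_eq)
qed

section \<open>The derivative and the differential expression\<close>

lemma AE_half_line_in: "AE x in lebesgue_on {l..}. (l::real) \<le> x"
  using AE_space[of "lebesgue_on {l..}"] by simp

lemma AE_lebesgue_on_negligibleD:
  assumes "AE x in lebesgue_on S. P x" "S \<in> sets lebesgue"
  obtains N where "negligible N" "\<And>x. x \<in> S \<Longrightarrow> x \<notin> N \<Longrightarrow> P x"
proof -
  have "AE x in lebesgue. x \<in> S \<longrightarrow> P x"
    using assms by (simp add: AE_restrict_space_iff)
  then obtain N where "N \<in> null_sets lebesgue" "{x \<in> space lebesgue. \<not> (x \<in> S \<longrightarrow> P x)} \<subseteq> N"
    unfolding eventually_ae_filter by blast
  then show ?thesis
    by (intro that[of N]) (auto simp: negligible_iff_null_sets)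
qed

lemma borel_measurable_lebesgue_on_AE:
  fixes f g :: "real \<Rightarrow> complex"
  assumes f: "f \<in> borel_measurable (lebesgue_on S)" and S: "S \<in> sets lebesgue"
    and AE: "AE x in lebesgue_on S. f x = g x"
  shows "g \<in> borel_measurable (lebesgue_on S)"
proof -
  have "AE x in lebesgue. (if x \<in> S then f x else 0) = (if x \<in> S then g x else 0)"
    using AE S by (auto simp: AE_restrict_space_iff)
  then have "(\<lambda>x. if x \<in> S then g x else 0) \<in> borel_measurable lebesgue"
    by (rule borel_measurable_AE[rotated]) (use f S in \<open>simp add: borel_measurable_if\<close>)
  then show ?thesis using S by (simp add: borel_measurable_if)
qed

lemma primitive_of_cong:
  assumes f: "primitive_of l f d"
    and "\<And>x. x \<ge> l \<Longrightarrow> f x = g x" and AE: "AE x in lebesgue_on {l..}. d x = e x"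
  shows "primitive_of l g e"
proof -
  obtain N where N: "negligible N" "\<And>x. x \<in> {l..} \<Longrightarrow> x \<notin> N \<Longrightarrow> d x = e x"
    using AE by (rule AE_lebesgue_on_negligibleD) auto
  have "e absolutely_integrable_on {l..b}" for b
    by (rule absolutely_integrable_spike[OF primitive_of_abs_integrable[OF f] N(1)]) (use N in auto)
  moreover have "integral {l..b} d = integral {l..b} e" for b
    by (rule Henstock_Kurzweil_Integration.integral_spike[OF N(1)]) (use N in auto)
  ultimately show ?thesis
    using primitive_of_eq[OF f] assms(2) unfolding primitive_of_def by (metis order_refl)
qed

lemma primitive_of_lincomb:
  assumes f: "primitive_of l f d" and g: "primitive_of l g e"
  shows "primitive_of l (\<lambda>x. a * f x + b * g x) (\<lambda>x. a * d x + b * e x)"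
  unfolding primitive_of_def
proof (intro allI impI conjI)
  fix t assume t: "l \<le> t"
  note d = primitive_of_abs_integrable[OF f, of t] and e = primitive_of_abs_integrable[OF g, of t]
  show "(\<lambda>x. a * d x + b * e x) absolutely_integrable_on {l..t}"
    using d e by (intro set_integral_add(1) set_integrable_mult_right) auto
  have "integral {l..t} (\<lambda>x. a * d x + b * e x) = a * integral {l..t} d + b * integral {l..t} e"
    using d e by (subst Henstock_Kurzweil_Integration.integral_add)
      (auto intro!: integrable_on_mult_right simp: set_lebesgue_integral_eq_integral(1))
  then show "a * f t + b * g t = a * f l + b * g l + integral {l..t} (\<lambda>x. a * d x + b * e x)"
    using primitive_of_eq[OF f t] primitive_of_eq[OF g t] by (simp add: algebra_simps)
qed

lemma half_line_within_nontrivial: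
  assumes "l \<le> x" shows "at x within {l..} \<noteq> (bot :: real filter)"
proof -
  have "x islimpt {x..x+1}" by (simp add: islimpt_Icc)
  then have "x islimpt {l..}" by (rule islimpt_subset) (use assms in auto)
  then show ?thesis by (simp add: trivial_limit_within)
qed

lemma D_eqI: "l \<le> x \<Longrightarrow> (y has_vector_derivative y') (at x within {l..}) \<Longrightarrow> D l y x = y'"
  unfolding D_def by (rule vector_derivative_within[OF half_line_within_nontrivial])

lemma D_cong: "l \<le> x \<Longrightarrow> (\<And>x. l \<le> x \<Longrightarrow> y x = z x) \<Longrightarrow> D l y x = D l z x"
  unfolding D_def by (rule vector_derivative_cong_eq) simp_all

lemma twice_AC_has_D:
  "twice_AC l y \<Longrightarrow> l \<le> x \<Longrightarrow> (y has_vector_derivative D l y x) (at x within {l..})"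
  by (simp add: twice_AC_def)

text \<open>
  By Lebesgue's theorem the density of \<open>D l y\<close> may be taken to be its derivative, whose values on the
  exceptional null set do not affect the integrals.
\<close>

lemma twice_AC_primitive_D:
  assumes "twice_AC l y"
  shows "primitive_of l (D l y) (D l (D l y))"
proof -
  obtain d where d: "primitive_of l (D l y) d"
    using assms by (auto simp: twice_AC_def locally_AC_iff)
  have "AE x in lebesgue_on {l..}. d x = D l (D l y) x"
    using primitive_of_AE_derivative[OF d] AE_half_line_in[of l]
    by eventually_elim (rule D_eqI[symmetric])
  then show ?thesis by (rule primitive_of_cong[OF d refl])
qed

lemma twice_AC_continuous_D:
  assumes "twice_AC l y" shows "continuous_on {l..} (D l y)"
  using primitive_of_continuous_on[OF twice_AC_primitive_D[OF assms]] by (rule continuous_on_half_lineI)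

lemma twice_AC_continuous:
  assumes "twice_AC l y" shows "continuous_on {l..} y"
  using twice_AC_has_D[OF assms] by (intro has_vector_derivative_imp_continuous_on) auto

lemma twice_AC_primitive:
  assumes "twice_AC l y" shows "primitive_of l y (D l y)"
  by (rule primitive_of_C1[OF twice_AC_has_D[OF assms] twice_AC_continuous_D[OF assms]])

lemma twice_ACI:
  assumes y1: "\<And>x. x \<ge> l \<Longrightarrow> (y has_vector_derivative y1 x) (at x within {l..})"
    and y2: "primitive_of l y1 y2"
  shows "twice_AC l y" and "\<And>x. x \<ge> l \<Longrightarrow> D l y x = y1 x"
    and "AE x in lebesgue_on {l..}. D l (D l y) x = y2 x"
proof -
  show D: "D l y x = y1 x" if "x \<ge> l" for x
    using that y1[OF that] by (rule D_eqI)
  have prim: "primitive_of l (D l y) y2"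
    using y2 by (rule primitive_of_cong) (simp_all add: D)
  have "continuous_on {l..} y1"
    using primitive_of_continuous_on[OF y2] by (rule continuous_on_half_lineI)
  then have "primitive_of l y y1" using y1 by (intro primitive_of_C1)
  then show "twice_AC l y"
    using y1 prim unfolding twice_AC_def locally_AC_iff by (metis D)
  show "AE x in lebesgue_on {l..}. D l (D l y) x = y2 x"
    using primitive_of_AE_derivative[OF prim] AE_half_line_in[of l]
    by eventually_elim (rule D_eqI)
qed

lemma twice_AC_lincomb:
  assumes "twice_AC l y" "twice_AC l z"
  shows "twice_AC l (\<lambda>x. a * y x + b * z x)"
    and "\<And>x. l \<le> x \<Longrightarrow> D l (\<lambda>x. a * y x + b * z x) x = a * D l y x + b * D l z x"
    and "AE x in lebesgue_on {l..}.
           schr q l (\<lambda>x. a * y x + b * z x) x = a * schr q l y x + b * schr q l z x"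
proof -
  have "((\<lambda>x. a * y x + b * z x) has_vector_derivative a * D l y x + b * D l z x) (at x within {l..})"
    if "l \<le> x" for x
    using assms[THEN twice_AC_has_D, OF that] by (auto intro!: derivative_eq_intros)
  note 1 = this
  note prim = primitive_of_lincomb[OF assms[THEN twice_AC_primitive_D], of a b]
  have 3: "AE x in lebesgue_on {l..}.
      D l (D l (\<lambda>x. a * y x + b * z x)) x = a * D l (D l y) x + b * D l (D l z) x"
    by (rule twice_ACI(3)[OF 1 prim])
  show "twice_AC l (\<lambda>x. a * y x + b * z x)"
    and "\<And>x. l \<le> x \<Longrightarrow> D l (\<lambda>x. a * y x + b * z x) x = a * D l y x + b * D l z x"
    by (rule twice_ACI(1,2)[OF 1 prim]; assumption)+
  show "AE x in lebesgue_on {l..}.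
           schr q l (\<lambda>x. a * y x + b * z x) x = a * schr q l y x + b * schr q l z x"
    using 3 by eventually_elim (simp add: schr_def algebra_simps)
qed

lemma twice_AC_mult_C2:
  assumes y: "twice_AC l y"
    and k: "\<And>x. (k has_vector_derivative k1 x) (at x)"
    and k1: "\<And>x. (k1 has_vector_derivative k2 x) (at x)" and k2: "continuous_on UNIV k2"
  shows "twice_AC l (\<lambda>x. k x * y x)"
    and "\<And>x. l \<le> x \<Longrightarrow> D l (\<lambda>x. k x * y x) x = k x * D l y x + k1 x * y x"
    and "AE x in lebesgue_on {l..}.
           schr q l (\<lambda>x. k x * y x) x = k x * schr q l y x - (2 * k1 x * D l y x + k2 x * y x)"
proof -
  have 1: "((\<lambda>x. k x * y x) has_vector_derivative k x * D l y x + k1 x * y x) (at x within {l..})"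
    if "l \<le> x" for x
    using twice_AC_has_D[OF y that] has_vector_derivative_at_within[OF k]
    by (auto intro!: derivative_eq_intros simp: mult.commute)
  have "continuous_on UNIV k1"
    using k1 has_vector_derivative_continuous continuous_on_eq_continuous_within by (metis)
  then have "continuous_on {l..} k1" "continuous_on {l..} k2"
    using k2 by (auto intro: continuous_on_subset)
  note cont = this
  have "primitive_of l (\<lambda>x. D l y x * k x) (\<lambda>x. D l (D l y) x * k x + D l y x * k1 x)"
    by (rule primitive_of_mult_C1[OF twice_AC_primitive_D[OF y] has_vector_derivative_at_within[OF k] cont(1)])
  moreover have "primitive_of l (\<lambda>x. y x * k1 x) (\<lambda>x. D l y x * k1 x + y x * k2 x)"
    by (rule primitive_of_mult_C1[OF twice_AC_primitive[OF y] has_vector_derivative_at_within[OF k1] cont(2)])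
  ultimately have "primitive_of l (\<lambda>x. 1 * (D l y x * k x) + 1 * (y x * k1 x))
      (\<lambda>x. 1 * (D l (D l y) x * k x + D l y x * k1 x) + 1 * (D l y x * k1 x + y x * k2 x))"
    by (rule primitive_of_lincomb)
  then have "primitive_of l (\<lambda>x. k x * D l y x + k1 x * y x)
          (\<lambda>x. k x * D l (D l y) x + (2 * k1 x * D l y x + k2 x * y x))"
    by (simp add: algebra_simps)
  note prim = this
  have 3: "AE x in lebesgue_on {l..}.
      D l (D l (\<lambda>x. k x * y x)) x = k x * D l (D l y) x + (2 * k1 x * D l y x + k2 x * y x)"
    by (rule twice_ACI(3)[OF 1 prim])
  show "twice_AC l (\<lambda>x. k x * y x)"
    and "\<And>x. l \<le> x \<Longrightarrow> D l (\<lambda>x. k x * y x) x = k x * D l y x + k1 x * y x"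
    by (rule twice_ACI(1,2)[OF 1 prim]; assumption)+
  show "AE x in lebesgue_on {l..}.
           schr q l (\<lambda>x. k x * y x) x = k x * schr q l y x - (2 * k1 x * D l y x + k2 x * y x)"
    using 3 by eventually_elim (simp add: schr_def algebra_simps)
qed

lemma twice_AC_cong:
  assumes "twice_AC l y" "\<And>x. l \<le> x \<Longrightarrow> y x = z x"
  shows "twice_AC l z" "\<And>x. l \<le> x \<Longrightarrow> D l z x = D l y x" "\<And>x. l \<le> x \<Longrightarrow> schr q l z x = schr q l y x"
proof -
  show D: "D l z x = D l y x" if "l \<le> x" for x
    using D_cong[OF that, of y z] assms(2) by simp
  show "schr q l z x = schr q l y x" if "l \<le> x" for x
    using D_cong[OF that, of "D l y" "D l z"] D assms(2)[OF that] by (simp add: schr_def)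
  have "(z has_vector_derivative D l y x) (at x within {l..})" if "l \<le> x" for x
    using twice_AC_has_D[OF assms(1) that]
    by (rule has_vector_derivative_transform[rotated 2]) (use that assms(2) in auto)
  then show "twice_AC l z"
    using twice_AC_primitive_D[OF assms(1)] by (rule twice_ACI(1))
qed

text \<open>
  The products \<open>y' cnj z\<close> and \<open>y cnj z'\<close> have one factor that is continuously differentiable, so the
  product rule applies to both; the terms with \<open>q\<close> cancel.
\<close>

lemma schr_green_interval:
  assumes y: "twice_AC l y" and z: "twice_AC l z" and b: "l \<le> b"
  shows "((\<lambda>x. schr q l y x * cnj (z x) - y x * cnj (schr q l z x)) has_integral
           (D l y l * cnj (z l) - y l * cnj (D l z l)) - (D l y b * cnj (z b) - y b * cnj (D l z b))) {l..b}"
proof -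
  have cnj_D: "((\<lambda>x. cnj (z x)) has_vector_derivative cnj (D l z x)) (at x within {l..})" if "l \<le> x" for x
    using twice_AC_has_D[OF z that] by (rule has_vector_derivative_cnj)
  have cnj_prim: "primitive_of l (\<lambda>x. cnj (D l z x)) (\<lambda>x. cnj (D l (D l z) x))"
    unfolding primitive_of_def
  proof (intro allI impI conjI)
    fix t assume t: "l \<le> t"
    note P = twice_AC_primitive_D[OF z]
    show "(\<lambda>x. cnj (D l (D l z) x)) absolutely_integrable_on {l..t}"
      using absolutely_integrable_linear[OF primitive_of_abs_integrable[OF P] bounded_linear_cnj]
      by (simp add: o_def)
    show "cnj (D l z t) = cnj (D l z l) + integral {l..t} (\<lambda>x. cnj (D l (D l z) x))"
      using primitive_of_eq[OF P t]
      by (metis Henstock_Kurzweil_Integration.integral_cnj complex_cnj_add)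
  qed
  have "primitive_of l (\<lambda>x. D l y x * cnj (z x)) (\<lambda>x. D l (D l y) x * cnj (z x) + D l y x * cnj (D l z x))"
    using cnj_D by (intro primitive_of_mult_C1 twice_AC_primitive_D y continuous_intros twice_AC_continuous_D z) auto
  moreover have "primitive_of l (\<lambda>x. cnj (D l z x) * y x) (\<lambda>x. cnj (D l (D l z) x) * y x + cnj (D l z x) * D l y x)"
    using twice_AC_has_D[OF y] by (intro primitive_of_mult_C1 cnj_prim twice_AC_continuous_D y) auto
  ultimately have "primitive_of l (\<lambda>x. (-1) * (D l y x * cnj (z x)) + 1 * (cnj (D l z x) * y x))
     (\<lambda>x. (-1) * (D l (D l y) x * cnj (z x) + D l y x * cnj (D l z x))
        + 1 * (cnj (D l (D l z) x) * y x + cnj (D l z x) * D l y x))"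
    by (rule primitive_of_lincomb)
  then have P: "primitive_of l (\<lambda>x. - (D l y x * cnj (z x) - y x * cnj (D l z x)))
     (\<lambda>x. schr q l y x * cnj (z x) - y x * cnj (schr q l z x))"
    by (rule primitive_of_cong) (auto simp: schr_def algebra_simps)
  show ?thesis
    using primitive_of_eq[OF P b] set_lebesgue_integral_eq_integral(1)[OF primitive_of_abs_integrable[OF P, of b]]
    by (simp add: has_integral_iff algebra_simps)
qed

section \<open>Square-integrable functions\<close>

lemma L2_measurable: "f \<in> L2 l \<Longrightarrow> f \<in> borel_measurable (lebesgue_on {l..})"
  and L2_integrable: "f \<in> L2 l \<Longrightarrow> integrable (lebesgue_on {l..}) (\<lambda>x. (cmod (f x))\<^sup>2)"
  by (auto simp: L2_def)

lemma borel_measurable_cnj_compose [measurable (raw)]: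
  "f \<in> borel_measurable M \<Longrightarrow> (\<lambda>x. cnj (f x)) \<in> borel_measurable M"
  by (rule measurable_compose[of _ _ borel]) (auto intro!: borel_measurable_continuous_onI continuous_intros)

lemma cmod_mult_le_squares: "cmod (a * b) \<le> ((cmod a)\<^sup>2 + (cmod b)\<^sup>2) / 2"
  using sum_squares_bound[of "cmod a" "cmod b"] by (simp add: norm_mult)

lemma L2_integrable_mult:
  assumes "f \<in> L2 l" "g \<in> L2 l"
  shows "integrable (lebesgue_on {l..}) (\<lambda>x. f x * cnj (g x))"
proof (rule Bochner_Integration.integrable_bound)
  show "integrable (lebesgue_on {l..}) (\<lambda>x. ((cmod (f x))\<^sup>2 + (cmod (g x))\<^sup>2) / 2)"
    using assms[THEN L2_integrable] by simp
  show "(\<lambda>x. f x * cnj (g x)) \<in> borel_measurable (lebesgue_on {l..})"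
    using assms[THEN L2_measurable] by measurable
  show "AE x in lebesgue_on {l..}. norm (f x * cnj (g x)) \<le> norm (((cmod (f x))\<^sup>2 + (cmod (g x))\<^sup>2) / 2)"
    by (rule AE_I2) (use cmod_mult_le_squares[of "f _" "cnj (g _)"] in simp)
qed

lemma L2_bound:
  assumes f: "f \<in> borel_measurable (lebesgue_on {l..})"
    and g: "integrable (lebesgue_on {l..}) g" and le: "\<And>x. l \<le> x \<Longrightarrow> (cmod (f x))\<^sup>2 \<le> g x"
  shows "f \<in> L2 l"
  unfolding L2_def
proof (intro CollectI conjI f)
  show "integrable (lebesgue_on {l..}) (\<lambda>x. (cmod (f x))\<^sup>2)"
    by (rule Bochner_Integration.integrable_bound[OF g])
      (use f le in \<open>auto intro!: AE_I2 intro: order_trans[OF _ abs_ge_self]\<close>)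
qed

lemma L2_lincomb:
  assumes "f \<in> L2 l" "g \<in> L2 l"
  shows "(\<lambda>x. a * f x + b * g x) \<in> L2 l"
proof (rule L2_bound)
  show "(\<lambda>x. a * f x + b * g x) \<in> borel_measurable (lebesgue_on {l..})"
    using assms[THEN L2_measurable] by simp
  show "integrable (lebesgue_on {l..}) (\<lambda>x. 2 * (cmod a)\<^sup>2 * (cmod (f x))\<^sup>2 + 2 * (cmod b)\<^sup>2 * (cmod (g x))\<^sup>2)"
    using assms[THEN L2_integrable] by simp
  fix x
  have "(cmod (a * f x + b * g x))\<^sup>2 \<le> (cmod (a * f x) + cmod (b * g x))\<^sup>2"
    by (intro power_mono norm_triangle_ineq) auto
  also have "\<dots> \<le> 2 * (cmod (a * f x))\<^sup>2 + 2 * (cmod (b * g x))\<^sup>2"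
    using sum_squares_bound[of "cmod (a * f x)" "cmod (b * g x)"] by (simp add: power2_sum)
  finally show "(cmod (a * f x + b * g x))\<^sup>2 \<le> 2 * (cmod a)\<^sup>2 * (cmod (f x))\<^sup>2 + 2 * (cmod b)\<^sup>2 * (cmod (g x))\<^sup>2"
    by (simp add: norm_mult power_mult_distrib mult.assoc)
qed

lemma L2_cong_AE:
  assumes f: "f \<in> L2 l" and AE: "AE x in lebesgue_on {l..}. f x = g x"
  shows "g \<in> L2 l"
proof -
  have g: "g \<in> borel_measurable (lebesgue_on {l..})"
    using L2_measurable[OF f] _ AE by (rule borel_measurable_lebesgue_on_AE) simp
  have "integrable (lebesgue_on {l..}) (\<lambda>x. (cmod (f x))\<^sup>2) \<longleftrightarrow> integrable (lebesgue_on {l..}) (\<lambda>x. (cmod (g x))\<^sup>2)"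
    using L2_measurable[OF f] g AE by (intro integrable_cong_AE) auto
  then show ?thesis using f g by (simp add: L2_def)
qed

lemma continuous_borel_measurable_half_line:
  fixes f :: "real \<Rightarrow> complex"
  shows "continuous_on {l..} f \<Longrightarrow> f \<in> borel_measurable (lebesgue_on {l..})"
  by (simp add: continuous_imp_measurable_on_sets_lebesgue)

lemma integrable_indicator_Icc:
  "integrable (lebesgue_on {l..}) (indicator {l..b} :: real \<Rightarrow> real)"
proof (rule integrable_real_indicator)
  show "{l..b} \<in> sets (lebesgue_on {l..})"
    by (auto simp: sets_restrict_space_iff)
  show "emeasure (lebesgue_on {l..}) {l..b} < \<infinity>"
    by (subst emeasure_restrict_space) (auto simp: emeasure_lborel_Icc_eq)
qed

lemma integral_indicator_Icc:
  assumes "l \<le> b"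
  shows "(\<integral>x. indicator {l..b} x \<partial>lebesgue_on {l..}) = (b - l :: real)"
proof -
  have "{l..b} \<inter> {l..} = {l..b}" by auto
  then have "(\<integral>x. indicator {l..b} x \<partial>lebesgue_on {l..}) = measure (lebesgue_on {l..}) {l..b}"
    by simp
  also have "\<dots> = b - l"
    using assms by (subst measure_restrict_space) auto
  finally show ?thesis .
qed

lemma L2_compact_support:
  fixes f :: "real \<Rightarrow> complex"
  assumes f: "continuous_on {l..} f" and zero: "\<And>x. b \<le> x \<Longrightarrow> f x = 0"
  shows "f \<in> L2 l"
proof -
  have "bounded (f ` {l..b})"
    using f by (intro compact_imp_bounded compact_continuous_image) (auto intro: continuous_on_subset)
  then obtain C where C: "\<And>x. x \<in> {l..b} \<Longrightarrow> cmod (f x) \<le> C"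
    unfolding bounded_iff by blast
  show ?thesis
  proof (rule L2_bound[OF continuous_borel_measurable_half_line[OF f]])
    show "integrable (lebesgue_on {l..}) (\<lambda>x. indicator {l..b} x * C\<^sup>2)"
      using integrable_indicator_Icc by (rule integrable_mult_left)
    fix x assume x: "l \<le> x"
    show "(cmod (f x))\<^sup>2 \<le> indicator {l..b} x * C\<^sup>2"
      using C[of x] zero[of x] x by (cases "x \<le> b") (auto intro!: power_mono)
  qed
qed

lemma L2_mult_bounded:
  fixes f k :: "real \<Rightarrow> complex"
  assumes f: "f \<in> L2 l" and k: "continuous_on {l..} k" and le: "\<And>x. l \<le> x \<Longrightarrow> cmod (k x) \<le> 1"
  shows "(\<lambda>x. k x * f x) \<in> L2 l"
proof (rule L2_bound)
  show "(\<lambda>x. k x * f x) \<in> borel_measurable (lebesgue_on {l..})"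
    using L2_measurable[OF f] continuous_borel_measurable_half_line[OF k] by simp
  show "integrable (lebesgue_on {l..}) (\<lambda>x. (cmod (f x))\<^sup>2)" using L2_integrable[OF f] .
  fix x assume "l \<le> x"
  then show "(cmod (k x * f x))\<^sup>2 \<le> (cmod (f x))\<^sup>2"
    using le[of x] mult_right_mono[of "cmod (k x)" 1 "cmod (f x)"]
    by (intro power_mono) (auto simp: norm_mult)
qed

lemma L2_inner_lincomb_left:
  assumes "f \<in> L2 l" "g \<in> L2 l" "h \<in> L2 l"
  shows "L2_inner l (\<lambda>x. a * f x + b * g x) h = a * L2_inner l f h + b * L2_inner l g h"
proof -
  have "L2_inner l (\<lambda>x. a * f x + b * g x) h =
      (\<integral>x. a * (f x * cnj (h x)) + b * (g x * cnj (h x)) \<partial>lebesgue_on {l..})"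
    by (simp add: L2_inner_def algebra_simps)
  also have "\<dots> = a * L2_inner l f h + b * L2_inner l g h"
    unfolding L2_inner_def
    using L2_integrable_mult[OF assms(1,3)] L2_integrable_mult[OF assms(2,3)]
    by (subst Bochner_Integration.integral_add) auto
  finally show ?thesis .
qed

lemma L2_inner_commute: "L2_inner l g f = cnj (L2_inner l f g)"
  unfolding L2_inner_def by (subst Bochner_Integration.integral_cnj[symmetric]) (simp add: mult.commute)

lemma L2_inner_lincomb_right:
  assumes "f \<in> L2 l" "g \<in> L2 l" "h \<in> L2 l"
  shows "L2_inner l h (\<lambda>x. a * f x + b * g x) = cnj a * L2_inner l h f + cnj b * L2_inner l h g"
  using L2_inner_lincomb_left[OF assms, of a b]
  by (subst (1 2 3) L2_inner_commute) simp

lemma L2_inner_cong_AE: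
  assumes f: "f \<in> L2 l" and h: "h \<in> L2 l" and AE: "AE x in lebesgue_on {l..}. f x = g x"
  shows "L2_inner l f h = L2_inner l g h"
  unfolding L2_inner_def
  using L2_measurable[OF f] L2_measurable[OF L2_cong_AE[OF f AE]] L2_measurable[OF h] AE
  by (intro integral_cong_AE) (measurable, auto)

lemma L2_inner_self: "L2_inner l f f = complex_of_real (\<integral>x. (cmod (f x))\<^sup>2 \<partial>lebesgue_on {l..})"
  unfolding L2_inner_def integral_complex_of_real[symmetric]
  by (rule Bochner_Integration.integral_cong) (simp_all only: complex_norm_square)

lemma L2_inner_self_nonneg: "0 \<le> Re (L2_inner l f f)"
  and L2_inner_self_Im: "Im (L2_inner l f f) = 0"
  by (auto simp: L2_inner_self)

lemma AE_half_line_continuous_zero: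
  fixes f :: "real \<Rightarrow> complex"
  assumes f: "continuous_on {l..} f" and AE: "AE x in lebesgue_on {l..}. f x = 0" and x: "l \<le> x"
  shows "f x = 0"
proof (rule ccontr)
  assume ne: "f x \<noteq> 0"
  obtain N where N: "negligible N" "\<And>x. x \<in> {l..} \<Longrightarrow> x \<notin> N \<Longrightarrow> f x = 0"
    using AE by (rule AE_lebesgue_on_negligibleD) auto
  obtain d where d: "d > 0" "\<And>y. l \<le> y \<Longrightarrow> dist y x < d \<Longrightarrow> dist (f y) (f x) < cmod (f x)"
    using f x ne unfolding continuous_on_iff by (metis atLeast_iff zero_less_norm_iff)
  have "{x..x + d/2} \<subseteq> N"
  proof
    fix y assume y: "y \<in> {x..x + d/2}"
    then have "dist (f y) (f x) < cmod (f x)" using d x by (auto simp: dist_real_def)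
    then have "f y \<noteq> 0" by auto
    then show "y \<in> N" using N(2)[of y] x y by auto
  qed
  then have "negligible {x..x + d/2}" using N(1) negligible_subset by blast
  then show False using d(1) negligible_interval(1)[of x "x + d/2"] by simp
qed

lemma L2_inner_self_eq_0:
  assumes L2: "f \<in> L2 l" and f: "continuous_on {l..} f" and zero: "L2_inner l f f = 0" and x: "l \<le> x"
  shows "f x = 0"
proof -
  have "AE x in lebesgue_on {l..}. (cmod (f x))\<^sup>2 = 0"
    using L2_integrable[OF L2] zero
    by (subst integral_nonneg_eq_0_iff_AE[symmetric]) (auto simp: L2_inner_self)
  then have "AE x in lebesgue_on {l..}. f x = 0" by simp
  with f show ?thesis using x by (rule AE_half_line_continuous_zero)
qed

section \<open>The maximal domain\<close>

lemma D_starD: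
  assumes "y \<in> D_star q l"
  shows D_star_L2: "y \<in> L2 l" and D_star_left: "x < l \<Longrightarrow> y x = 0" and D_star_AC: "twice_AC l y"
    and D_star_schr: "schr q l y \<in> L2 l"
  using assms by (auto simp: D_star_def)

lemma D_star_lincomb:
  fixes a b :: complex
  assumes "y \<in> D_star q l" "z \<in> D_star q l"
  shows "(\<lambda>x. a * y x + b * z x) \<in> D_star q l"
    and "D l (\<lambda>x. a * y x + b * z x) l = a * D l y l + b * D l z l"
    and "f \<in> L2 l \<Longrightarrow> L2_inner l (schr q l (\<lambda>x. a * y x + b * z x)) f =
            a * L2_inner l (schr q l y) f + b * L2_inner l (schr q l z) f"
proof -
  note * = twice_AC_lincomb[OF assms[THEN D_star_AC], where a = a and b = b]
  note L = L2_lincomb[OF assms[THEN D_star_schr], of a b]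
  have eq: "AE x in lebesgue_on {l..}.
       a * schr q l y x + b * schr q l z x = schr q l (\<lambda>x. a * y x + b * z x) x"
    using *(3)[where q = q] by eventually_elim simp
  show "(\<lambda>x. a * y x + b * z x) \<in> D_star q l"
    using assms *(1) L2_lincomb[OF assms[THEN D_star_L2], of a b] L2_cong_AE[OF L eq]
    by (simp add: D_star_def)
  show "D l (\<lambda>x. a * y x + b * z x) l = a * D l y l + b * D l z l"
    by (rule *(2)) simp
  show "L2_inner l (schr q l (\<lambda>x. a * y x + b * z x)) f =
            a * L2_inner l (schr q l y) f + b * L2_inner l (schr q l z) f" if "f \<in> L2 l"
    unfolding L2_inner_cong_AE[OF L that eq, symmetric]
    by (rule L2_inner_lincomb_left) (use assms[THEN D_star_schr] that in auto)
qed

section \<open>Cutoff functions\<close>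

lemma has_real_derivative_max_0_power:
  fixes s :: real
  shows "((\<lambda>s. max 0 s ^ Suc (Suc n)) has_real_derivative real (Suc (Suc n)) * max 0 s ^ Suc n) (at s)"
proof -
  consider "s > 0" | "s < 0" | "s = 0" by linarith
  then show ?thesis
  proof cases
    case 1
    have "((\<lambda>s. s ^ Suc (Suc n)) has_real_derivative real (Suc (Suc n)) * s ^ Suc n) (at s)"
      using DERIV_pow[of "Suc (Suc n)" s UNIV] by (simp del: power_Suc of_nat_Suc)
    then have "((\<lambda>s. max 0 s ^ Suc (Suc n)) has_real_derivative real (Suc (Suc n)) * s ^ Suc n) (at s)"
      by (rule has_field_derivative_transform_within_open[of _ _ _ "{0<..}"]) (use 1 in auto)
    then show ?thesis using 1 by (simp del: power_Suc of_nat_Suc)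
  next
    case 2
    have "((\<lambda>s. 0) has_real_derivative 0) (at s)" by simp
    then have "((\<lambda>s. max 0 s ^ Suc (Suc n)) has_real_derivative 0) (at s)"
      by (rule has_field_derivative_transform_within_open[of _ _ _ "{..<0}"]) (use 2 in auto)
    then show ?thesis using 2 by simp
  next
    case 3
    have "((\<lambda>h::real. max 0 h ^ Suc (Suc n) / h) \<longlongrightarrow> 0) (at 0)"
    proof (rule Lim_null_comparison)
      have "((\<lambda>h::real. \<bar>h\<bar> ^ Suc n) \<longlongrightarrow> \<bar>0\<bar> ^ Suc n) (at 0)" by (intro tendsto_intros)
      then show "((\<lambda>h::real. \<bar>h\<bar> ^ Suc n) \<longlongrightarrow> 0) (at 0)" by simp
      show "\<forall>\<^sub>F h in at 0. norm (max 0 h ^ Suc (Suc n) / h) \<le> \<bar>h\<bar> ^ Suc n"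
      proof (intro always_eventually allI)
        fix h :: real
        show "norm (max 0 h ^ Suc (Suc n) / h) \<le> \<bar>h\<bar> ^ Suc n"
          by (cases "0 \<le> h") (simp_all add: max_def del: power_Suc, simp add: abs_mult)
      qed
    qed
    then show ?thesis using 3 by (simp add: DERIV_def)
  qed
qed

text \<open>
  The third power makes the function twice continuously differentiable at \<open>l + e\<close>, and the square inside
  makes its derivative vanish at \<open>l\<close>. Multiplication by it thus preserves membership in \<open>D\<^sup>*\<close> as
  well as the value and the slope at \<open>l\<close>. A smooth function of compact support is in general not in \<open>D\<^sup>*\<close>
  because \<open>q\<close> is merely locally summable; this is why functions near \<open>l\<close> are made by cutting off given
  members of \<open>D\<^sup>*\<close>.
\<close>

definition cutoff :: "real \<Rightarrow> real \<Rightarrow> real \<Rightarrow> real" where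
  "cutoff l e x = max 0 (1 - ((x - l) / e)\<^sup>2) ^ 3"

text \<open>
  With \<open>\<tau> = (x - l) / e\<close> and \<open>r = max 0 (1 - \<tau>\<^sup>2)\<close> the derivatives are \<open>-6 \<tau> r\<^sup>2 / e\<close> and
  \<open>(24 \<tau>\<^sup>2 r - 6 r\<^sup>2) / e\<^sup>2\<close>. The bounds follow since \<open>0 \<le> r \<le> 1\<close>, and \<open>r = 0\<close> unless \<open>\<bar>\<tau>\<bar> < 1\<close>.
\<close>

lemma cutoff_C2:
  assumes e: "e > 0"
  obtains k1 k2 where
    "\<And>x. ((\<lambda>x. complex_of_real (cutoff l e x)) has_vector_derivative k1 x) (at x)"
    "\<And>x. (k1 has_vector_derivative k2 x) (at x)" "continuous_on UNIV k2"
    "k1 l = 0" "\<And>x. cmod (k1 x) \<le> 6 / e" "\<And>x. cmod (k2 x) \<le> 30 / e\<^sup>2"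
    "\<And>x. l + e \<le> x \<Longrightarrow> k1 x = 0" "\<And>x. l + e \<le> x \<Longrightarrow> k2 x = 0"
proof -
  define t where "t = (\<lambda>x. (x - l) / e)"
  define r where "r = (\<lambda>x. max 0 (1 - (t x)\<^sup>2))"
  define k1 where "k1 = (\<lambda>x. 3 * (r x)\<^sup>2 * (- 2 * t x / e))"
  define k2 where "k2 = (\<lambda>x. 3 * (2 * r x * (- 2 * t x / e)) * (- 2 * t x / e) + 3 * (r x)\<^sup>2 * (- 2 / e\<^sup>2))"
  have t: "(t has_real_derivative 1 / e) (at x)" for x
    unfolding t_def using e by (auto intro!: derivative_eq_intros)
  have s: "((\<lambda>x. 1 - (t x)\<^sup>2) has_real_derivative - 2 * t x / e) (at x)" for x
    using t[of x] by (auto intro!: derivative_eq_intros)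
  have r2: "((\<lambda>x. (r x)\<^sup>2) has_real_derivative (2 * r x * (- 2 * t x / e))) (at x)" for x
    using DERIV_chain2[OF has_real_derivative_max_0_power[of 0] s, of x]
    by (simp add: r_def eval_nat_numeral algebra_simps)
  have r3: "((\<lambda>x. (r x) ^ 3) has_real_derivative (3 * (r x)\<^sup>2 * (- 2 * t x / e))) (at x)" for x
    using DERIV_chain2[OF has_real_derivative_max_0_power[of 1] s, of x]
    by (simp add: r_def eval_nat_numeral algebra_simps)
  have k1: "(k1 has_real_derivative k2 x) (at x)" for x
  proof -
    have "((\<lambda>x. - 2 * t x / e) has_real_derivative - 2 / e\<^sup>2) (at x)"
      using t[of x] e by (auto intro!: derivative_eq_intros simp: power2_eq_square)
    from DERIV_cmult[OF DERIV_mult[OF r2 this], of 3] show ?thesis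
      unfolding k1_def k2_def by (simp add: algebra_simps)
  qed
  have cut: "cutoff l e = (\<lambda>x. r x ^ 3)" by (simp add: cutoff_def r_def t_def fun_eq_iff)
  have r01: "0 \<le> r x" "r x \<le> 1" for x by (auto simp: r_def)
  have r0: "r x = 0" if "1 \<le> \<bar>t x\<bar>" for x
    using that power_mono[of 1 "\<bar>t x\<bar>" 2] by (simp add: r_def)
  have r_big: "r x = 0" if "l + e \<le> x" for x
    using that e by (intro r0) (simp add: t_def pos_le_divide_eq)
  have r2_1: "(r x)\<^sup>2 \<le> 1" for x using r01[of x] by (simp add: power_le_one)
  have rt: "r x * \<bar>t x\<bar> \<le> 1" "(r x)\<^sup>2 * \<bar>t x\<bar> \<le> 1" "r x * (t x)\<^sup>2 \<le> 1" for x
  proof -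
    show "r x * \<bar>t x\<bar> \<le> 1"
      using mult_mono[of "r x" 1 "\<bar>t x\<bar>" 1] r01[of x] r0[of x] by (cases "1 \<le> \<bar>t x\<bar>") auto
    show "(r x)\<^sup>2 * \<bar>t x\<bar> \<le> 1"
      using mult_mono[of "(r x)\<^sup>2" 1 "\<bar>t x\<bar>" 1] r2_1[of x] r0[of x] by (cases "1 \<le> \<bar>t x\<bar>") auto
    show "r x * (t x)\<^sup>2 \<le> 1"
      using mult_mono[of "r x" 1 "(t x)\<^sup>2" 1] r01[of x] r0[of x] power_le_one[of "\<bar>t x\<bar>" 2]
      by (cases "1 \<le> \<bar>t x\<bar>") auto
  qed
  have b1: "\<bar>k1 x\<bar> \<le> 6 / e" for x
  proof -
    have "\<bar>k1 x\<bar> = 6 / e * ((r x)\<^sup>2 * \<bar>t x\<bar>)" using e by (simp add: k1_def abs_mult)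
    also have "\<dots> \<le> 6 / e * 1" using e rt by (intro mult_left_mono) auto
    finally show ?thesis by simp
  qed
  have b2: "\<bar>k2 x\<bar> \<le> 30 / e\<^sup>2" for x
  proof -
    have "k2 x = 24 / e\<^sup>2 * (r x * (t x)\<^sup>2) - 6 / e\<^sup>2 * (r x)\<^sup>2"
      by (simp add: k2_def power2_eq_square)
    also have "\<bar>\<dots>\<bar> \<le> 24 / e\<^sup>2 * (r x * (t x)\<^sup>2) + 6 / e\<^sup>2 * (r x)\<^sup>2"
      using r01[of x] by (intro order_trans[OF abs_triangle_ineq4]) (simp add: abs_mult)
    also have "\<dots> \<le> 24 / e\<^sup>2 * 1 + 6 / e\<^sup>2 * 1"
      using rt(3)[of x] r2_1[of x] by (intro add_mono mult_left_mono) auto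
    finally show ?thesis by simp
  qed
  have cont: "continuous_on UNIV (\<lambda>x. complex_of_real (k2 x))"
    using e unfolding k2_def r_def t_def by (intro continuous_intros) auto
  have v: "((\<lambda>x. complex_of_real (f x)) has_vector_derivative complex_of_real f') (at x)"
    if "(f has_real_derivative f') (at x)" for f f' x
    using that by (rule has_vector_derivative_of_real)
  show ?thesis
  proof (rule that[of "\<lambda>x. complex_of_real (k1 x)" "\<lambda>x. complex_of_real (k2 x)"])
    show "((\<lambda>x. complex_of_real (cutoff l e x)) has_vector_derivative complex_of_real (k1 x)) (at x)" for x
      unfolding cut k1_def by (rule v[OF r3])
    show "((\<lambda>x. complex_of_real (k1 x)) has_vector_derivative complex_of_real (k2 x)) (at x)" for x
      by (rule v[OF k1])
    show "complex_of_real (k1 l) = 0" by (simp add: k1_def t_def)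
    show "complex_of_real (k1 x) = 0" "complex_of_real (k2 x) = 0" if "l + e \<le> x" for x
      using r_big[OF that] by (simp_all add: k1_def k2_def)
    show "cmod (complex_of_real (k1 x)) \<le> 6 / e" "cmod (complex_of_real (k2 x)) \<le> 30 / e\<^sup>2" for x
      using b1[of x] b2[of x] by (simp_all only: norm_of_real)
  qed (rule cont)
qed

lemma cutoff_nonneg: "0 \<le> cutoff l e x" and cutoff_le_1: "cutoff l e x \<le> 1"
  and cutoff_at [simp]: "cutoff l e l = 1"
  by (auto simp: cutoff_def power_le_one)

lemma cutoff_zero:
  assumes "e > 0" "l + e \<le> x"
  shows "cutoff l e x = 0"
proof -
  have "1 \<le> (x - l) / e" using assms by (simp add: pos_le_divide_eq)
  then have "1 \<le> ((x - l) / e)\<^sup>2" using power_mono[of 1 "(x - l) / e" 2] by simp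
  then show ?thesis by (simp add: cutoff_def)
qed

lemma cutoff_less_1:
  assumes "e > 0" "l < x"
  shows "cutoff l e x < 1"
proof -
  have "0 < ((x - l) / e)\<^sup>2" using assms by simp
  then have "max 0 (1 - ((x - l) / e)\<^sup>2) < 1" by simp
  then show ?thesis unfolding cutoff_def by (intro power_less_one_iff[THEN iffD2]) auto
qed

lemma continuous_cutoff: "e > 0 \<Longrightarrow> continuous_on S (\<lambda>x. complex_of_real (cutoff l e x))"
  unfolding cutoff_def by (intro continuous_intros) auto

text \<open>
  By the product rule, \<open>l(\<chi> y) - \<chi> l(y)\<close> only involves \<open>y\<close> and \<open>y'\<close>; it is continuous of compact support
  and therefore square-integrable.
\<close>

lemma D_star_cutoff:
  assumes y: "y \<in> D_star q l" and e: "e > 0"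
  defines "w \<equiv> (\<lambda>x. complex_of_real (cutoff l e x) * y x)"
  shows "w \<in> D_star q l" and "w l = y l" and "D l w l = D l y l"
proof -
  obtain k1 k2 where k:
    "\<And>x. ((\<lambda>x. complex_of_real (cutoff l e x)) has_vector_derivative k1 x) (at x)"
    "\<And>x. (k1 has_vector_derivative k2 x) (at x)" "continuous_on UNIV k2"
    "k1 l = 0" "\<And>x. l + e \<le> x \<Longrightarrow> k1 x = 0" "\<And>x. l + e \<le> x \<Longrightarrow> k2 x = 0"
    using cutoff_C2[OF e, of l] by metis
  note AC = D_star_AC[OF y]
  note * = twice_AC_mult_C2[OF AC k(1,2,3), folded w_def]
  have "continuous_on UNIV k1"
    using has_vector_derivative_imp_continuous_on[of UNIV k1 k2] k(2) by simp
  then have "continuous_on {l..} (\<lambda>x. 2 * k1 x * D l y x + k2 x * y x)"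
    using twice_AC_continuous_D[OF AC] twice_AC_continuous[OF AC] continuous_on_subset[OF k(3), of "{l..}"]
      continuous_on_subset[of UNIV k1 "{l..}"] by (intro continuous_intros) simp_all
  then have "(\<lambda>x. 2 * k1 x * D l y x + k2 x * y x) \<in> L2 l"
    by (rule L2_compact_support[of _ _ "l + e"]) (simp add: k(5,6))
  moreover have "(\<lambda>x. complex_of_real (cutoff l e x) * schr q l y x) \<in> L2 l"
    using D_star_schr[OF y] continuous_cutoff[OF e]
    by (rule L2_mult_bounded) (simp add: cutoff_nonneg cutoff_le_1)
  ultimately have "(\<lambda>x. 1 * (complex_of_real (cutoff l e x) * schr q l y x)
       + (-1) * (2 * k1 x * D l y x + k2 x * y x)) \<in> L2 l"
    by (intro L2_lincomb)
  then have "schr q l w \<in> L2 l"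
    by (rule L2_cong_AE) (use *(3)[where q = q] in \<open>eventually_elim, simp\<close>)
  moreover have "w \<in> L2 l"
    unfolding w_def using D_star_L2[OF y] continuous_cutoff[OF e]
    by (rule L2_mult_bounded) (simp add: cutoff_nonneg cutoff_le_1)
  ultimately show "w \<in> D_star q l"
    using *(1) D_star_left[OF y] by (simp add: D_star_def w_def)
  show "w l = y l" by (simp add: w_def)
  show "D l w l = D l y l" using *(2)[of l] k(4) by simp
qed

section \<open>Green's formula for functions of compact support\<close>

lemma D_zero_beyond:
  assumes "\<And>x. b < x \<Longrightarrow> y x = 0" "l \<le> x" "b < x"
  shows "D l y x = 0"
proof -
  have "D l y x = D l (\<lambda>_. 0) x"
    unfolding D_def
  proof (rule vector_derivative_cong_eq)
    have "eventually (\<lambda>x. x \<in> {b<..}) (nhds x)"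
      using assms(3) by (intro eventually_nhds_in_open) auto
    then show "eventually (\<lambda>x. x \<in> {l..} \<longrightarrow> y x = 0) (nhds x)"
      by eventually_elim (use assms(1) in auto)
  qed (use assms(2) in auto)
  also have "\<dots> = 0"
    using assms(2) by (rule D_eqI) simp
  finally show ?thesis .
qed

text \<open>
  Up to sign, the boundary term at infinity in Green's formula.
\<close>

definition green_defect :: "(real \<Rightarrow> real) \<Rightarrow> real \<Rightarrow> (real \<Rightarrow> complex) \<Rightarrow> (real \<Rightarrow> complex) \<Rightarrow> complex" where
  "green_defect q l y z = L2_inner l (schr q l y) z - L2_inner l y (schr q l z)
     - (D l y l * cnj (z l) - y l * cnj (D l z l))"

lemma green_defect_lincomb_left:
  assumes "y \<in> D_star q l" "y' \<in> D_star q l" "z \<in> D_star q l"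
  shows "green_defect q l (\<lambda>x. a * y x + b * y' x) z = a * green_defect q l y z + b * green_defect q l y' z"
  using D_star_lincomb(2,3)[OF assms(1,2), where a = a and b = b] D_star_L2[OF assms(3)]
    L2_inner_lincomb_left[OF D_star_L2[OF assms(1)] D_star_L2[OF assms(2)] D_star_schr[OF assms(3)], of a b]
  unfolding green_defect_def by (simp add: algebra_simps)

lemma green_defect_swap: "green_defect q l z y = - cnj (green_defect q l y z)"
  using L2_inner_commute[of l "schr q l z" y] L2_inner_commute[of l z "schr q l y"]
  unfolding green_defect_def by simp

lemma green_defect_compact:
  assumes y: "y \<in> D_star q l" and z: "z \<in> D_star q l" and b: "l \<le> b" and zero: "\<And>x. b \<le> x \<Longrightarrow> y x = 0"
  shows "green_defect q l y z = 0"
proof -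
  let ?F = "\<lambda>x. schr q l y x * cnj (z x) - y x * cnj (schr q l z x)"
  have Dy: "D l y x = 0" if "b < x" for x
    using zero that b by (intro D_zero_beyond[of b]) auto
  have DDy: "D l (D l y) x = 0" if "b < x" for x
    by (rule D_zero_beyond[of b]) (use Dy that b in auto)
  have F0: "?F x = 0" if "b < x" for x
    using that zero[of x] DDy[of x] by (simp add: schr_def)
  have "(?F has_integral (D l y l * cnj (z l) - y l * cnj (D l z l))) {l..b+1}"
    using schr_green_interval[OF D_star_AC[OF y] D_star_AC[OF z], of "b+1" q] b Dy[of "b+1"] zero[of "b+1"]
    by simp
  then have "(?F has_integral (D l y l * cnj (z l) - y l * cnj (D l z l))) {l..}"
    by (rule has_integral_on_superset)
       (use F0 D_star_left[OF y] D_star_left[OF z] in \<open>auto simp: not_le\<close>)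
  moreover have int: "integrable (lebesgue_on {l..}) ?F"
    using L2_integrable_mult[OF D_star_schr[OF y] D_star_L2[OF z]]
      L2_integrable_mult[OF D_star_L2[OF y] D_star_schr[OF z]] by simp
  ultimately have "integral\<^sup>L (lebesgue_on {l..}) ?F = D l y l * cnj (z l) - y l * cnj (D l z l)"
    using lebesgue_integral_eq_integral[OF int] by (simp add: integral_unique)
  then show ?thesis
    using L2_integrable_mult[OF D_star_schr[OF y] D_star_L2[OF z]]
      L2_integrable_mult[OF D_star_L2[OF y] D_star_schr[OF z]]
    by (simp add: green_defect_def L2_inner_def)
qed

section \<open>Functions concentrated at the end point\<close>

text \<open>
  The functions are \<open>w = \<chi> u\<close> with the cutoff \<open>\<chi>\<close> of width \<open>e\<close>. On \<open>[l, l + e]\<close> one has \<open>\<bar>u\<bar> \<le> C e\<close> and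
  \<open>\<bar>u'\<bar> \<le> C\<close>, and the derivatives of \<open>\<chi>\<close> are of the orders \<open>1 / e\<close> and \<open>1 / e\<^sup>2\<close>. So \<open>\<bar>w\<bar> \<le> C e\<close>, while \<open>l(w)\<close> is
  bounded by \<open>\<bar>l(u)\<bar>\<close> plus a term of order \<open>1 / e\<close>. The product \<open>l(w) cnj w\<close> is then integrated over an interval of length
  \<open>e\<close>, and its integral is of order \<open>e\<close>.
\<close>

lemma concentrated_functions:
  assumes u: "u \<in> D_star q l" "u l = 0" "D l u l = 1"
  obtains w :: "nat \<Rightarrow> real \<Rightarrow> complex" where
    "\<And>n. w n \<in> D_star q l" "\<And>n. w n l = 0" "\<And>n. D l (w n) l = 1"
    "\<And>f. f \<in> L2 l \<Longrightarrow> (\<lambda>n. L2_inner l f (w n)) \<longlonglongrightarrow> 0"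
    "(\<lambda>n. L2_inner l (schr q l (w n)) (w n)) \<longlonglongrightarrow> 0"
proof -
  note AC = D_star_AC[OF u(1)]
  define S where "S = schr q l u"
  have S: "S \<in> L2 l" unfolding S_def using u(1) by (rule D_star_schr)
  have "bounded (D l u ` {l..l+1})"
    by (intro compact_imp_bounded compact_continuous_image continuous_on_subset[OF twice_AC_continuous_D[OF AC]]) auto
  then obtain C where C: "0 < C" "\<And>x. x \<in> {l..l+1} \<Longrightarrow> cmod (D l u x) \<le> C"
    by (auto simp: bounded_pos)
  have u_le: "cmod (u x) \<le> C * (x - l)" if "x \<in> {l..l+1}" for x
  proof -
    note P = twice_AC_primitive[OF AC]
    have "u x = integral {l..x} (D l u)"
      using primitive_of_eq[OF P, of x] that u(2) by simp
    also have "cmod \<dots> \<le> integral {l..x} (\<lambda>_. C)"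
      by (rule Henstock_Kurzweil_Integration.integral_norm_bound_integral)
        (use that C set_lebesgue_integral_eq_integral(1)[OF primitive_of_abs_integrable[OF P]] in auto)
    finally show ?thesis using that by (simp add: mult.commute)
  qed
  define N where "N = (\<lambda>f. \<integral>x. (cmod (f x))\<^sup>2 \<partial>lebesgue_on {l..} :: real)"
  define W where "W = (\<lambda>e x. complex_of_real (cutoff l e x) * u x)"
  let ?I = "\<lambda>e. indicator {l..l+e} :: real \<Rightarrow> real"
  have W_D: "W e \<in> D_star q l" "W e l = 0" "D l (W e) l = 1" if "0 < e" for e
    using D_star_cutoff[OF u(1) that] u(2,3) by (simp_all add: W_def)
  have W_le: "cmod (W e x) \<le> C * e * ?I e x" if "0 < e" "e \<le> 1" "l \<le> x" for e x
  proof (cases "x \<le> l + e")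
    case True
    have "cmod (W e x) \<le> 1 * cmod (u x)"
      unfolding W_def norm_mult by (intro mult_right_mono) (auto simp: cutoff_nonneg cutoff_le_1)
    also have "\<dots> \<le> C * (x - l)" using u_le[of x] True that by simp
    also have "\<dots> \<le> C * e" using True C(1) by (intro mult_left_mono) auto
    finally show ?thesis using True that by simp
  next
    case False
    then show ?thesis using cutoff_zero[OF that(1), of l x] by (simp add: W_def)
  qed
  have int_I: "integrable (lebesgue_on {l..}) (?I e)" for e
    by (rule integrable_indicator_Icc)
  have val_I: "(\<integral>x. ?I e x \<partial>lebesgue_on {l..}) = e" if "0 < e" for e
    using integral_indicator_Icc[of l "l + e"] that by simp
  have half: "a * ?I e x \<le> (a\<^sup>2 + ?I e x) / 2" for a e x
    using sum_squares_bound[of a 1] by (cases "x \<in> {l..l+e}") simp_all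
  have inner_le: "cmod (L2_inner l f (W e)) \<le> C * e * (N f + 1) / 2"
    if f: "f \<in> L2 l" and e: "0 < e" "e \<le> 1" for f e
  proof -
    have "cmod (L2_inner l f (W e)) \<le> (\<integral>x. C * e * (((cmod (f x))\<^sup>2 + ?I e x) / 2) \<partial>lebesgue_on {l..})"
      unfolding L2_inner_def
    proof (rule Bochner_Integration.integral_norm_bound_integral)
      show "integrable (lebesgue_on {l..}) (\<lambda>x. f x * cnj (W e x))"
        using f D_star_L2[OF W_D(1)[OF e(1)]] by (rule L2_integrable_mult)
      show "integrable (lebesgue_on {l..}) (\<lambda>x. C * e * (((cmod (f x))\<^sup>2 + ?I e x) / 2))"
        using L2_integrable[OF f] int_I by simp
      fix x assume "x \<in> space (lebesgue_on {l..})"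
      then have x: "l \<le> x" by simp
      have "cmod (f x * cnj (W e x)) \<le> cmod (f x) * (C * e * ?I e x)"
        using W_le[OF e x] by (simp add: norm_mult mult_left_mono)
      also have "\<dots> = C * e * (cmod (f x) * ?I e x)" by simp
      also have "\<dots> \<le> C * e * (((cmod (f x))\<^sup>2 + ?I e x) / 2)"
        using C(1) e(1) by (intro mult_left_mono half) auto
      finally show "cmod (f x * cnj (W e x)) \<le> C * e * (((cmod (f x))\<^sup>2 + ?I e x) / 2)" .
    qed
    also have "\<dots> = C * e * ((N f + e) / 2)"
      using L2_integrable[OF f] int_I val_I[OF e(1)] by (simp add: N_def)
    also have "\<dots> \<le> C * e * ((N f + 1) / 2)"
      using C(1) e by (intro mult_left_mono) auto
    finally show ?thesis by simp
  qed
  \<comment> \<open>\<open>42 = 2 * 6 + 30\<close>, from \<open>2 \<chi>' u'\<close> and \<open>\<chi>'' u\<close> with the bounds of the cutoff \<open>\<chi>\<close>\<close>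
  have energy_le: "cmod (L2_inner l (schr q l (W e)) (W e)) \<le> C * e * (N S + 1) / 2 + 42 * C\<^sup>2 * e"
    if e: "0 < e" "e \<le> 1" for e
  proof -
    obtain k1 k2 where k:
      "\<And>x. ((\<lambda>x. complex_of_real (cutoff l e x)) has_vector_derivative k1 x) (at x)"
      "\<And>x. (k1 has_vector_derivative k2 x) (at x)" "continuous_on UNIV k2"
      "\<And>x. cmod (k1 x) \<le> 6 / e" "\<And>x. cmod (k2 x) \<le> 30 / e\<^sup>2"
      using cutoff_C2[OF e(1), of l] by metis
    define R where "R = (\<lambda>x. complex_of_real (cutoff l e x) * S x - (2 * k1 x * D l u x + k2 x * u x))"
    have eq: "AE x in lebesgue_on {l..}. schr q l (W e) x = R x"
      using twice_AC_mult_C2(3)[OF AC k(1,2,3), of q] by (simp add: W_def R_def S_def)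
    note WD = W_D(1)[OF e(1)]
    have R: "R \<in> L2 l" using D_star_schr[OF WD] eq by (rule L2_cong_AE)
    have "L2_inner l (schr q l (W e)) (W e) = L2_inner l R (W e)"
      by (rule L2_inner_cong_AE[OF D_star_schr[OF WD] D_star_L2[OF WD] eq])
    also have "cmod \<dots> \<le> (\<integral>x. C * e * (((cmod (S x))\<^sup>2 + ?I e x) / 2) + 42 * C\<^sup>2 * ?I e x \<partial>lebesgue_on {l..})"
      unfolding L2_inner_def
    proof (rule Bochner_Integration.integral_norm_bound_integral)
      show "integrable (lebesgue_on {l..}) (\<lambda>x. R x * cnj (W e x))"
        using R D_star_L2[OF WD] by (rule L2_integrable_mult)
      show "integrable (lebesgue_on {l..}) (\<lambda>x. C * e * (((cmod (S x))\<^sup>2 + ?I e x) / 2) + 42 * C\<^sup>2 * ?I e x)"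
        using L2_integrable[OF S] int_I by simp
      fix x assume "x \<in> space (lebesgue_on {l..})"
      then have x: "l \<le> x" by simp
      show "cmod (R x * cnj (W e x)) \<le> C * e * (((cmod (S x))\<^sup>2 + ?I e x) / 2) + 42 * C\<^sup>2 * ?I e x"
      proof (cases "x \<le> l + e")
        case False
        then have "W e x = 0" using cutoff_zero[OF e(1), of l x] by (simp add: W_def)
        then show ?thesis using C(1) e(1) by simp
      next
        case True
        then have x1: "x \<in> {l..l+1}" using x e by simp
        have I: "?I e x = 1" using x True by simp
        have "cmod (R x) \<le> cmod (complex_of_real (cutoff l e x) * S x) + cmod (2 * k1 x * D l u x + k2 x * u x)"
          unfolding R_def by (rule norm_triangle_ineq4)
        also have "\<dots> \<le> cmod (S x) + (12 / e * C + 30 / e\<^sup>2 * (C * e))"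
        proof (rule add_mono)
          have "cmod (complex_of_real (cutoff l e x) * S x) \<le> 1 * cmod (S x)"
            unfolding norm_mult by (intro mult_right_mono) (auto simp: cutoff_nonneg cutoff_le_1)
          then show "cmod (complex_of_real (cutoff l e x) * S x) \<le> cmod (S x)" by simp
          have "cmod (2 * k1 x * D l u x + k2 x * u x) \<le> 2 * cmod (k1 x) * cmod (D l u x) + cmod (k2 x) * cmod (u x)"
            using norm_triangle_ineq[of "2 * k1 x * D l u x" "k2 x * u x"] by (simp add: norm_mult)
          also have "\<dots> \<le> (2 * (6 / e)) * C + 30 / e\<^sup>2 * (C * e)"
          proof (intro add_mono mult_mono)
            have "cmod (u x) \<le> C * (x - l)" using u_le[OF x1] .
            also have "\<dots> \<le> C * e" using True C(1) by (intro mult_left_mono) auto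
            finally show "cmod (u x) \<le> C * e" .
          qed (use k(4,5) C x1 e in auto)
          finally show "cmod (2 * k1 x * D l u x + k2 x * u x) \<le> 12 / e * C + 30 / e\<^sup>2 * (C * e)" by simp
        qed
        also have "\<dots> = cmod (S x) + 42 * C / e"
          using e(1) by (simp add: field_simps power2_eq_square)
        finally have "cmod (R x * cnj (W e x)) \<le> (cmod (S x) + 42 * C / e) * (C * e)"
          unfolding norm_mult using W_le[OF e x] I C(1) e(1) by (intro mult_mono) auto
        also have "\<dots> = C * e * (cmod (S x) * ?I e x) + 42 * C\<^sup>2 * ?I e x"
          using e(1) I by (simp add: field_simps power2_eq_square)
        also have "\<dots> \<le> C * e * (((cmod (S x))\<^sup>2 + ?I e x) / 2) + 42 * C\<^sup>2 * ?I e x"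
          using C(1) e(1) by (intro add_mono mult_left_mono half) auto
        finally show ?thesis .
      qed
    qed
    also have "\<dots> = C * e * ((N S + e) / 2) + 42 * C\<^sup>2 * e"
      using L2_integrable[OF S] int_I val_I[OF e(1)] by (simp add: N_def)
    also have "\<dots> \<le> C * e * ((N S + 1) / 2) + 42 * C\<^sup>2 * e"
      using C(1) e by (intro add_mono mult_left_mono) auto
    finally show ?thesis by simp
  qed
  define \<epsilon> where "\<epsilon> = (\<lambda>n. inverse (real (Suc n)))"
  have \<epsilon>: "0 < \<epsilon> n" "\<epsilon> n \<le> 1" for n by (auto simp: \<epsilon>_def inverse_le_1_iff)
  have \<epsilon>0: "\<epsilon> \<longlonglongrightarrow> 0" unfolding \<epsilon>_def by (rule LIMSEQ_inverse_real_of_nat)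
  show ?thesis
  proof (rule that[of "\<lambda>n. W (\<epsilon> n)"])
    show "(\<lambda>n. L2_inner l f (W (\<epsilon> n))) \<longlonglongrightarrow> 0" if f: "f \<in> L2 l" for f
    proof (rule Lim_null_comparison[OF always_eventually])
      show "\<forall>n. cmod (L2_inner l f (W (\<epsilon> n))) \<le> C * \<epsilon> n * (N f + 1) / 2"
        using inner_le[OF f \<epsilon>] by blast
      have "(\<lambda>n. C * \<epsilon> n * (N f + 1) / 2) \<longlonglongrightarrow> C * 0 * (N f + 1) / 2"
        by (intro tendsto_intros \<epsilon>0) simp
      then show "(\<lambda>n. C * \<epsilon> n * (N f + 1) / 2) \<longlonglongrightarrow> 0" by simp
    qed
    show "(\<lambda>n. L2_inner l (schr q l (W (\<epsilon> n))) (W (\<epsilon> n))) \<longlonglongrightarrow> 0"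
    proof (rule Lim_null_comparison[OF always_eventually])
      show "\<forall>n. cmod (L2_inner l (schr q l (W (\<epsilon> n))) (W (\<epsilon> n))) \<le> C * \<epsilon> n * (N S + 1) / 2 + 42 * C\<^sup>2 * \<epsilon> n"
        using energy_le[OF \<epsilon>] by blast
      have "(\<lambda>n. C * \<epsilon> n * (N S + 1) / 2 + 42 * C\<^sup>2 * \<epsilon> n) \<longlonglongrightarrow> C * 0 * (N S + 1) / 2 + 42 * C\<^sup>2 * 0"
        by (intro tendsto_intros \<epsilon>0) simp
      then show "(\<lambda>n. C * \<epsilon> n * (N S + 1) / 2 + 42 * C\<^sup>2 * \<epsilon> n) \<longlonglongrightarrow> 0" by simp
    qed
  qed (use W_D \<epsilon> in auto)
qed

section \<open>Weyl solutions\<close>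

text \<open>
  The solution \<open>\<phi>\<^sub>2 + M z \<phi>\<^sub>1\<close> has to be set to zero on the left of \<open>l\<close> in order to be a member of \<open>D\<^sup>*\<close>.
\<close>

lemma weyl_solution:
  assumes M: "weyl_function q l M" and z: "z \<notin> \<real>\<^sub>\<ge>\<^sub>0"
  obtains \<psi> where "\<psi> \<in> D_star q l" "\<psi> l = -1" "D l \<psi> l = M z"
    "\<And>f. f \<in> L2 l \<Longrightarrow> L2_inner l (schr q l \<psi>) f = z * L2_inner l \<psi> f"
proof -
  obtain \<phi>1 \<phi>2 where \<phi>: "is_solution q l z \<phi>1" "\<phi>1 l = 0" "D l \<phi>1 l = 1"
    "is_solution q l z \<phi>2" "\<phi>2 l = -1" "D l \<phi>2 l = 0" "(\<lambda>x. \<phi>2 x + M z * \<phi>1 x) \<in> L2 l"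
    using M z unfolding weyl_function_def by blast
  let ?p = "\<lambda>x. 1 * \<phi>2 x + M z * \<phi>1 x"
  define \<psi> where "\<psi> = (\<lambda>x. if l \<le> x then ?p x else 0)"
  have AC: "twice_AC l \<phi>2" "twice_AC l \<phi>1" using \<phi> by (auto simp: is_solution_def)
  note * = twice_AC_lincomb[OF AC, where a = 1 and b = "M z"]
  have eq: "?p x = \<psi> x" if "l \<le> x" for x using that by (simp add: \<psi>_def)
  note ** = twice_AC_cong[OF *(1) eq]
  have L2: "\<psi> \<in> L2 l"
    using \<phi>(7) by (rule L2_cong_AE) (use AE_half_line_in[of l] in \<open>eventually_elim, simp add: \<psi>_def\<close>)
  have "AE x in lebesgue_on {l..}. schr q l \<phi>1 x = z * \<phi>1 x" "AE x in lebesgue_on {l..}. schr q l \<phi>2 x = z * \<phi>2 x"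
    using \<phi> by (auto simp: is_solution_def)
  then have ev: "AE x in lebesgue_on {l..}. z * \<psi> x = schr q l \<psi> x"
    using *(3)[where q = q] AE_half_line_in[of l]
  proof eventually_elim
    case (elim x)
    have "schr q l \<psi> x = schr q l ?p x"
      by (rule **(3)) (use elim in auto)
    with elim show ?case by (simp add: \<psi>_def algebra_simps)
  qed
  have zL2: "(\<lambda>x. z * \<psi> x) \<in> L2 l"
    using L2_lincomb[OF L2 L2, of z 0] by simp
  show ?thesis
  proof (rule that[of \<psi>])
    show "\<psi> \<in> D_star q l"
      using L2 **(1) L2_cong_AE[OF zL2 ev] by (simp add: D_star_def \<psi>_def)
    show "\<psi> l = -1" using \<phi> by (simp add: \<psi>_def)
    show "D l \<psi> l = M z" using **(2)[of l] *(2)[of l] \<phi> by simp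
    show "L2_inner l (schr q l \<psi>) f = z * L2_inner l \<psi> f" if f: "f \<in> L2 l" for f
      using L2_inner_cong_AE[OF zL2 f ev] L2_inner_lincomb_left[OF L2 L2 f, of z 0] by simp
  qed
qed

section \<open>The form of the maximal operator\<close>

definition boundary_form :: "(real \<Rightarrow> real) \<Rightarrow> real \<Rightarrow> (real \<Rightarrow> complex) \<Rightarrow> (real \<Rightarrow> complex) \<Rightarrow> complex" where
  "boundary_form q l y z = L2_inner l (schr q l y) z - D l y l * cnj (z l)"

lemma boundary_form_lincomb_left:
  assumes "y \<in> D_star q l" "y' \<in> D_star q l" "z \<in> D_star q l"
  shows "boundary_form q l (\<lambda>x. a * y x + b * y' x) z = a * boundary_form q l y z + b * boundary_form q l y' z"
  using D_star_lincomb(2)[OF assms(1,2), where a = a and b = b]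
    D_star_lincomb(3)[OF assms(1,2) D_star_L2[OF assms(3)], where a = a and b = b]
  unfolding boundary_form_def by (simp add: algebra_simps)

locale nonnegative_schroedinger =
  fixes q :: "real \<Rightarrow> real" and l :: real
  assumes nonneg: "nonnegative_op l (dom_min q l) (schr q l)"
begin

lemma green_defect_dom_min_diag:
  assumes "f \<in> dom_min q l"
  shows "green_defect q l f f = 0"
proof -
  have "L2_inner l (schr q l f) f \<in> \<real>"
    using nonneg assms nonneg_Reals_subset_Reals unfolding nonnegative_op_def by blast
  then have "cnj (L2_inner l (schr q l f) f) = L2_inner l (schr q l f) f"
    by (simp add: Reals_cnj_iff)
  then show ?thesis
    using assms L2_inner_commute[of l f "schr q l f"] by (simp add: green_defect_def dom_min_def)
qed

lemma dom_min_lincomb: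
  assumes "f \<in> dom_min q l" "g \<in> dom_min q l"
  shows "(\<lambda>x. a * f x + b * g x) \<in> dom_min q l"
  using assms D_star_lincomb(1,2)[of f q l g] by (simp add: dom_min_def)

text \<open>
  Polarization: the sesquilinear defect vanishes on the diagonal of a complex vector space.
\<close>

lemma green_defect_dom_min:
  assumes f: "f \<in> dom_min q l" and g: "g \<in> dom_min q l"
  shows "green_defect q l f g = 0"
proof -
  have fD: "f \<in> D_star q l" and gD: "g \<in> D_star q l" using f g by (auto simp: dom_min_def)
  have expand: "c * green_defect q l f g + cnj c * green_defect q l g f = 0" for c
  proof -
    let ?h = "\<lambda>x. c * f x + 1 * g x"
    have h: "?h \<in> dom_min q l" using f g by (rule dom_min_lincomb)
    then have hD: "?h \<in> D_star q l" by (simp add: dom_min_def)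
    have left: "green_defect q l ?h z = c * green_defect q l f z + 1 * green_defect q l g z"
      if "z \<in> D_star q l" for z
      using fD gD that by (rule green_defect_lincomb_left)
    have swap: "green_defect q l z ?h = cnj c * green_defect q l z f + green_defect q l z g"
      if "z \<in> D_star q l" for z
    proof -
      have "green_defect q l z ?h = - cnj (c * green_defect q l f z + green_defect q l g z)"
        using left[OF that] green_defect_swap[of q l z ?h] by simp
      then show ?thesis
        unfolding green_defect_swap[of q l z f] green_defect_swap[of q l z g] by simp
    qed
    have "green_defect q l ?h ?h = 0" using h by (rule green_defect_dom_min_diag)
    then show ?thesis
      using left[OF hD] swap[OF fD] swap[OF gD] green_defect_dom_min_diag[OF f] green_defect_dom_min_diag[OF g]
      by (simp add: algebra_simps)
  qed
  have "green_defect q l f g + green_defect q l g f = 0"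
    using expand[of 1] by simp
  moreover have "\<i> * (green_defect q l f g - green_defect q l g f) = 0"
    using expand[of \<i>] by (simp add: algebra_simps)
  ultimately show ?thesis by simp
qed

lemma cutoff_remainder_dom_min:
  assumes y: "y \<in> D_star q l" and e: "0 < e"
  shows "(\<lambda>x. 1 * y x + (-1) * (complex_of_real (cutoff l e x) * y x)) \<in> dom_min q l"
  using D_star_lincomb(1,2)[OF y D_star_cutoff(1)[OF y e], where a = 1 and b = "-1"] D_star_cutoff(3)[OF y e]
  by (simp add: dom_min_def)

text \<open>
  Splitting off the part near \<open>l\<close> by a cutoff does not change the defect, because the defect vanishes if
  one of the functions has compact support. What remains are members of the minimal domain.
\<close>

lemma green:
  assumes y: "y \<in> D_star q l" and z: "z \<in> D_star q l"
  shows "L2_inner l (schr q l y) z - L2_inner l y (schr q l z) = D l y l * cnj (z l) - y l * cnj (D l z l)"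
proof -
  define near where "near = (\<lambda>y x. complex_of_real (cutoff l 1 x) * (y x :: complex))"
  define far where "far = (\<lambda>y x. 1 * y x + (-1) * near y x)"
  have near: "near y \<in> D_star q l" if "y \<in> D_star q l" for y
    unfolding near_def using D_star_cutoff(1)[OF that, of 1] by simp
  have far: "far y \<in> dom_min q l" "far y \<in> D_star q l" if "y \<in> D_star q l" for y
    using cutoff_remainder_dom_min[OF that, of 1] by (auto simp: far_def near_def dom_min_def)
  have near0: "green_defect q l (near y) z = 0" if "y \<in> D_star q l" "z \<in> D_star q l" for y z
    by (rule green_defect_compact[OF near[OF that(1)] that(2), of "l + 1"])
       (auto simp: near_def cutoff_zero)
  have split: "green_defect q l y z = green_defect q l (far y) z"
    if "y \<in> D_star q l" "z \<in> D_star q l" for y z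
    using green_defect_lincomb_left[OF that(1) near[OF that(1)] that(2), of 1 "-1"] near0[OF that]
    by (simp add: far_def)
  have "green_defect q l y z = green_defect q l (far y) z"
    by (rule split[OF y z])
  also have "\<dots> = - cnj (green_defect q l z (far y))" by (rule green_defect_swap)
  also have "\<dots> = - cnj (green_defect q l (far z) (far y))"
    by (subst split[OF z far(2)[OF y]]) simp
  also have "\<dots> = 0" using far[OF y] far[OF z] by (simp add: green_defect_dom_min)
  finally show ?thesis by (simp add: green_defect_def)
qed

lemma boundary_form_hermitian:
  assumes "y \<in> D_star q l" "z \<in> D_star q l"
  shows "boundary_form q l z y = cnj (boundary_form q l y z)"
  using green[OF assms(2,1)] L2_inner_commute[of l z "schr q l y"]
  by (simp add: boundary_form_def algebra_simps)

lemma boundary_form_real: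
  assumes "y \<in> D_star q l"
  shows "boundary_form q l y y = complex_of_real (Re (boundary_form q l y y))"
  using boundary_form_hermitian[OF assms assms] by (simp add: complex_eq_iff)

lemma boundary_form_expand:
  assumes y: "y \<in> D_star q l" and z: "z \<in> D_star q l"
  shows "Re (boundary_form q l (\<lambda>x. 1 * y x + c * z x) (\<lambda>x. 1 * y x + c * z x)) =
    Re (boundary_form q l y y) + 2 * Re (cnj c * boundary_form q l y z) + (cmod c)\<^sup>2 * Re (boundary_form q l z z)"
proof -
  let ?h = "\<lambda>x. 1 * y x + c * z x"
  have h: "?h \<in> D_star q l" using y z by (rule D_star_lincomb)
  have left: "boundary_form q l ?h v = 1 * boundary_form q l y v + c * boundary_form q l z v"
    if "v \<in> D_star q l" for v
    using y z that by (rule boundary_form_lincomb_left)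
  have right: "boundary_form q l v ?h = boundary_form q l v y + cnj c * boundary_form q l v z"
    if "v \<in> D_star q l" for v
    using left[OF that] boundary_form_hermitian[OF h that] boundary_form_hermitian[OF y that]
      boundary_form_hermitian[OF z that] by simp
  define a where "a = boundary_form q l y z"
  have a': "boundary_form q l z y = cnj a"
    unfolding a_def using y z by (rule boundary_form_hermitian)
  have "boundary_form q l ?h ?h = boundary_form q l y y + cnj c * a + c * cnj a + (c * cnj c) * boundary_form q l z z"
    using left[OF h] right[OF y] right[OF z] a' by (simp add: a_def algebra_simps)
  also have "c * cnj c = complex_of_real ((cmod c)\<^sup>2)" by (simp only: complex_norm_square)
  finally show ?thesis by (simp add: a_def[symmetric])
qed

lemma boundary_form_dom_min:
  assumes "f \<in> dom_min q l"
  shows "0 \<le> Re (boundary_form q l f f)"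
proof -
  have "L2_inner l (schr q l f) f \<in> \<real>\<^sub>\<ge>\<^sub>0"
    using nonneg assms unfolding nonnegative_op_def by blast
  then show ?thesis using assms by (simp add: boundary_form_def dom_min_def complex_nonneg_Reals_iff)
qed

text \<open>
  The energy cost of changing the slope at \<open>l\<close> tends to zero.
\<close>

lemma boundary_form_perturb_tendsto:
  assumes y: "y \<in> D_star q l"
    and w: "\<And>n. w n \<in> D_star q l" "\<And>n. w n l = 0"
      "\<And>f. f \<in> L2 l \<Longrightarrow> (\<lambda>n. L2_inner l f (w n)) \<longlonglongrightarrow> 0"
      "(\<lambda>n. L2_inner l (schr q l (w n)) (w n)) \<longlonglongrightarrow> 0"
  shows "(\<lambda>n. Re (boundary_form q l (\<lambda>x. 1 * y x + c * w n x) (\<lambda>x. 1 * y x + c * w n x)))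
     \<longlonglongrightarrow> Re (boundary_form q l y y)"
proof -
  have "(\<lambda>n. Re (boundary_form q l y y) + 2 * Re (cnj c * L2_inner l (schr q l y) (w n))
       + (cmod c)\<^sup>2 * Re (L2_inner l (schr q l (w n)) (w n)))
     \<longlonglongrightarrow> Re (boundary_form q l y y) + 2 * Re (cnj c * 0) + (cmod c)\<^sup>2 * Re 0"
    by (intro tendsto_intros w(3,4) D_star_schr[OF y])
  then show ?thesis
    unfolding boundary_form_expand[OF y w(1)] by (simp add: boundary_form_def w(2))
qed

end

section \<open>Lower bound of the form by the Weyl function\<close>

locale weyl_schroedinger = nonnegative_schroedinger +
  fixes M :: "complex \<Rightarrow> complex"
  assumes weyl: "weyl_function q l M"
begin

text \<open>
  The Weyl solutions at \<open>\<i>\<close> and \<open>-\<i>\<close> make the left side of Green's formula zero, and its right side is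
  \<open>cnj (M (-\<i>)) - M \<i>\<close>.
\<close>

lemma M_cnj: "M (- \<i>) = cnj (M \<i>)"
proof -
  obtain \<psi> where \<psi>: "\<psi> \<in> D_star q l" "\<psi> l = -1" "D l \<psi> l = M \<i>"
    "\<And>f. f \<in> L2 l \<Longrightarrow> L2_inner l (schr q l \<psi>) f = \<i> * L2_inner l \<psi> f"
    using weyl_solution[OF weyl, of \<i>] by (auto simp: complex_nonneg_Reals_iff)
  obtain \<eta> where \<eta>: "\<eta> \<in> D_star q l" "\<eta> l = -1" "D l \<eta> l = M (- \<i>)"
    "\<And>f. f \<in> L2 l \<Longrightarrow> L2_inner l (schr q l \<eta>) f = - \<i> * L2_inner l \<eta> f"
    using weyl_solution[OF weyl, of "- \<i>"] by (auto simp: complex_nonneg_Reals_iff)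
  have "L2_inner l \<psi> (schr q l \<eta>) = \<i> * L2_inner l \<psi> \<eta>"
    using \<eta>(4)[OF D_star_L2[OF \<psi>(1)]] L2_inner_commute[of l \<psi> "schr q l \<eta>"] L2_inner_commute[of l \<psi> \<eta>]
    by simp
  then show ?thesis
    using green[OF \<psi>(1) \<eta>(1)] \<psi>(4)[OF D_star_L2[OF \<eta>(1)]] \<psi>(2,3) \<eta>(2,3)
    by (metis add.inverse_inverse complex_cnj_cnj complex_cnj_minus complex_cnj_one diff_self eq_iff_diff_eq_0 mult.commute mult_minus1)
qed

text \<open>
  The form takes the value \<open>\<i> \<parallel>\<psi>\<parallel>\<^sup>2 + M \<i>\<close> at the Weyl solution \<open>\<psi>\<close> at \<open>\<i>\<close>, and it is real.
\<close>

lemma M_Im_neg: "Im (M \<i>) < 0"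
proof -
  obtain \<psi> where \<psi>: "\<psi> \<in> D_star q l" "\<psi> l = -1" "D l \<psi> l = M \<i>"
    "\<And>f. f \<in> L2 l \<Longrightarrow> L2_inner l (schr q l \<psi>) f = \<i> * L2_inner l \<psi> f"
    using weyl_solution[OF weyl, of \<i>] by (auto simp: complex_nonneg_Reals_iff)
  have "Im (boundary_form q l \<psi> \<psi>) = 0"
    using boundary_form_real[OF \<psi>(1)] by (metis Im_complex_of_real)
  then have eq: "Im (M \<i>) = - Re (L2_inner l \<psi> \<psi>)"
    using \<psi>(4)[OF D_star_L2[OF \<psi>(1)]] \<psi>(2,3) by (simp add: boundary_form_def)
  have "L2_inner l \<psi> \<psi> \<noteq> 0"
    using L2_inner_self_eq_0[OF D_star_L2[OF \<psi>(1)] twice_AC_continuous[OF D_star_AC[OF \<psi>(1)]], of l] \<psi>(2)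
    by auto
  then show ?thesis
    using eq L2_inner_self_nonneg[of l \<psi>] L2_inner_self_Im[of l \<psi>] by (auto simp: complex_eq_iff)
qed

text \<open>
  Since \<open>M \<i> \<noteq> M (-\<i>)\<close>, the Weyl solutions at \<open>\<i>\<close> and \<open>-\<i>\<close> have different slopes and the same value at \<open>l\<close>.
\<close>

lemma D_star_unit_slope:
  obtains u where "u \<in> D_star q l" "u l = 0" "D l u l = 1"
proof -
  obtain \<psi> where \<psi>: "\<psi> \<in> D_star q l" "\<psi> l = -1" "D l \<psi> l = M \<i>"
    using weyl_solution[OF weyl, of \<i>] by (auto simp: complex_nonneg_Reals_iff)
  obtain \<eta> where \<eta>: "\<eta> \<in> D_star q l" "\<eta> l = -1" "D l \<eta> l = M (- \<i>)"
    using weyl_solution[OF weyl, of "- \<i>"] by (auto simp: complex_nonneg_Reals_iff)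
  define d where "d = 1 / (M \<i> - M (- \<i>))"
  have ne: "M \<i> - M (- \<i>) \<noteq> 0"
    using M_Im_neg by (simp add: M_cnj complex_eq_iff)
  show ?thesis
  proof (rule that)
    show "(\<lambda>x. d * \<psi> x + (- d) * \<eta> x) \<in> D_star q l"
      using \<psi>(1) \<eta>(1) by (rule D_star_lincomb)
    have "D l (\<lambda>x. d * \<psi> x + (- d) * \<eta> x) l = d * (M \<i> - M (- \<i>))"
      using D_star_lincomb(2)[OF \<psi>(1) \<eta>(1), where a = d and b = "- d"] \<psi>(3) \<eta>(3)
      by (simp add: algebra_simps)
    then show "D l (\<lambda>x. d * \<psi> x + (- d) * \<eta> x) l = 1"
      using ne by (simp add: d_def)
  qed (use \<psi>(2) \<eta>(2) in simp)
qed

text \<open>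
  A multiple of a concentrated function brings \<open>v\<close> into the minimal domain.
\<close>

lemma boundary_form_vanishing_value:
  assumes v: "v \<in> D_star q l" "v l = 0"
  shows "0 \<le> Re (boundary_form q l v v)"
proof -
  obtain u where u: "u \<in> D_star q l" "u l = 0" "D l u l = 1" by (rule D_star_unit_slope)
  obtain w where w: "\<And>n. w n \<in> D_star q l" "\<And>n. w n l = 0" "\<And>n. D l (w n) l = 1"
    "\<And>f. f \<in> L2 l \<Longrightarrow> (\<lambda>n. L2_inner l f (w n)) \<longlonglongrightarrow> 0"
    "(\<lambda>n. L2_inner l (schr q l (w n)) (w n)) \<longlonglongrightarrow> 0"
    by (rule concentrated_functions[OF u], rule that) blast+
  let ?c = "- D l v l"
  \<comment> \<open>subtracting \<open>v'(l) w n\<close> cancels the slope and keeps the value \<open>0\<close>\<close>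
  have "(\<lambda>x. 1 * v x + ?c * w n x) \<in> dom_min q l" for n
    using D_star_lincomb(1,2)[OF v(1) w(1), where a = 1 and b = ?c] v(2) w(2,3)[of n]
    by (simp add: dom_min_def)
  note * = boundary_form_dom_min[OF this]
  show ?thesis
    by (rule LIMSEQ_le_const[OF boundary_form_perturb_tendsto[OF v(1) w(1,2,4,5), where c = ?c]])
       (use * in blast)+
qed

text \<open>
  Let \<open>\<psi>\<close> be the Weyl solution at \<open>t\<close> and \<open>v = y + y(l) \<psi>\<close>, which vanishes at \<open>l\<close>. The difference
  between the form and \<open>t\<close> times the inner product couples \<open>v\<close> and \<open>\<psi>\<close> to zero, because \<open>\<psi>\<close> is an
  eigenfunction. So \<open>Q(y, y) - t \<parallel>y\<parallel>\<^sup>2\<close> is the sum of \<open>Q(v, v) - t \<parallel>v\<parallel>\<^sup>2 \<ge> 0\<close> and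
  \<open>\<bar>y(l)\<bar>\<^sup>2 M(t)\<close>.
\<close>

lemma boundary_form_lower_bound_negative:
  fixes t :: real
  assumes y: "y \<in> D_star q l" and t: "t < 0"
  shows "(cmod (y l))\<^sup>2 * Re (M t) + t * Re (L2_inner l y y) \<le> Re (boundary_form q l y y)"
proof -
  obtain \<psi> where \<psi>: "\<psi> \<in> D_star q l" "\<psi> l = -1" "D l \<psi> l = M t"
    "\<And>f. f \<in> L2 l \<Longrightarrow> L2_inner l (schr q l \<psi>) f = complex_of_real t * L2_inner l \<psi> f"
    using weyl_solution[OF weyl, of "complex_of_real t"] t by (auto simp: complex_nonneg_Reals_iff)
  define a where "a = y l"
  define v where "v = (\<lambda>x. 1 * y x + a * \<psi> x)"
  have v: "v \<in> D_star q l" "v l = 0"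
    unfolding v_def by (rule D_star_lincomb(1)[OF y \<psi>(1)], simp add: a_def \<psi>(2))
  define p where "p = L2_inner l v \<psi>"
  have y_eq: "y = (\<lambda>x. 1 * v x + (- a) * \<psi> x)" by (simp add: v_def fun_eq_iff)
  have pp: "Re (boundary_form q l \<psi> \<psi>) = t * Re (L2_inner l \<psi> \<psi>) + Re (M t)"
    using \<psi> D_star_L2[OF \<psi>(1)] by (simp add: boundary_form_def)
  have "boundary_form q l \<psi> v = t * L2_inner l \<psi> v"
    using \<psi>(4) D_star_L2[OF v(1)] v(2) by (simp add: boundary_form_def)
  then have vp: "boundary_form q l v \<psi> = t * p"
    using boundary_form_hermitian[OF \<psi>(1) v(1)] L2_inner_commute[of l v \<psi>] by (simp add: p_def)
  have 1: "Re (boundary_form q l y y) = Re (boundary_form q l v v) + 2 * (t * Re (cnj (- a) * p))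
      + (cmod a)\<^sup>2 * (t * Re (L2_inner l \<psi> \<psi>) + Re (M t))"
    using boundary_form_expand[OF v(1) \<psi>(1), of "- a"] unfolding y_eq[symmetric]
    by (simp add: pp vp algebra_simps)
  have 2: "Re (L2_inner l y y) = Re (L2_inner l v v) + 2 * Re (cnj (- a) * p) + (cmod a)\<^sup>2 * Re (L2_inner l \<psi> \<psi>)"
  proof -
    note L = D_star_L2[OF v(1)] D_star_L2[OF \<psi>(1)] 
    have "L2_inner l y y = L2_inner l v v + cnj (- a) * p + (- a) * cnj p + (a * cnj a) * L2_inner l \<psi> \<psi>"
      using L2_inner_lincomb_left[OF L D_star_L2[OF y], of 1 "- a"]
        L2_inner_lincomb_right[OF L L(1), of 1 "- a"] L2_inner_lincomb_right[OF L L(2), of 1 "- a"]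
        L2_inner_commute[of l \<psi> v]
      unfolding y_eq[symmetric] p_def by (simp add: algebra_simps)
    also have "a * cnj a = complex_of_real ((cmod a)\<^sup>2)" by (simp only: complex_norm_square)
    finally show ?thesis by simp
  qed
  have "t * Re (L2_inner l y y) = t * Re (L2_inner l v v) + 2 * (t * Re (cnj (- a) * p))
      + (cmod a)\<^sup>2 * (t * Re (L2_inner l \<psi> \<psi>))"
    unfolding 2 by (simp add: algebra_simps)
  moreover have "0 \<le> Re (boundary_form q l v v)"
    using v by (rule boundary_form_vanishing_value)
  moreover have "t * Re (L2_inner l v v) \<le> 0"
    using t L2_inner_self_nonneg[of l v] by (simp add: mult_nonpos_nonneg)
  ultimately show ?thesis
    using 1 by (simp add: a_def[symmetric] distrib_left)
qed

end

section \<open>The transfer function\<close>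

lemma of_real_sqrt_square: "0 \<le> x \<Longrightarrow> complex_of_real (sqrt x) * complex_of_real (sqrt x) = complex_of_real x"
  by (simp flip: of_real_mult)

text \<open>
  With \<open>g = \<mu> a - b\<close> and \<open>c = 1 / (\<mu> - h)\<close> the expression is a real number plus \<open>c \<bar>g\<bar>\<^sup>2\<close>, and \<open>Im c > 0\<close>. This is
  \<open>Im \<A> = K K\<^sup>*\<close> on the diagonal, where \<open>a\<close> and \<open>b\<close> are value and slope at \<open>l\<close>.
\<close>

lemma dissipation_identity:
  fixes a b h :: complex and \<mu> :: real
  assumes "Im h > 0"
  shows "0 \<le> Im (b * cnj a - 1 / (\<mu> - h) * (b - h * a) * (\<mu> * cnj a - cnj b))"
proof -
  define g where "g = \<mu> * a - b"
  define c where "c = 1 / (\<mu> - h)"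
  have ne: "\<mu> - h \<noteq> 0" using assms by (auto simp: complex_eq_iff)
  have "c * (b - h * a) = a - c * g"
    using ne by (simp add: c_def g_def field_simps)
  then have "b * cnj a - c * (b - h * a) * (\<mu> * cnj a - cnj b) = b * cnj a - (a - c * g) * cnj g"
    by (simp add: g_def)
  also have "\<dots> = (b * cnj a + cnj (b * cnj a)) - \<mu> * (a * cnj a) + c * (g * cnj g)"
    by (simp add: g_def algebra_simps)
  also have "\<dots> = (b * cnj a + cnj (b * cnj a)) - \<mu> * complex_of_real ((cmod a)\<^sup>2) + c * complex_of_real ((cmod g)\<^sup>2)"
    by (simp only: complex_norm_square)
  also have "Im \<dots> = Im c * (cmod g)\<^sup>2" by simp
  also have "\<dots> \<ge> 0"
    using assms by (simp add: c_def Im_divide)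
  finally show ?thesis by (simp add: c_def)
qed

lemma coupled_form_Im_nonneg:
  fixes a b h :: complex
  assumes "Im h > 0"
  shows "0 \<le> Im (b * cnj a - (case \<mu> of
        Some m \<Rightarrow> 1 / (complex_of_real m - h) * (b - h * a) * (complex_of_real m * cnj a - cnj b)
      | None \<Rightarrow> (b - h * a) * cnj a))"
proof (cases \<mu>)
  case None
  have "b * cnj a - (b - h * a) * cnj a = h * (a * cnj a)" by (simp add: algebra_simps)
  also have "\<dots> = h * complex_of_real ((cmod a)\<^sup>2)" by (simp only: complex_norm_square)
  finally show ?thesis using assms None by simp
next
  case (Some m)
  then show ?thesis using dissipation_identity[OF assms, of b a m] by simp
qed

context nonnegative_schroedinger
begin

text \<open>
  If \<open>w\<close> is in the kernel of \<open>\<A> + \<i>\<close>, then testing with \<open>w\<close> and taking imaginary parts gives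
  \<open>Im (\<A> w, w) + \<parallel>w\<parallel>\<^sup>2 = 0\<close> with two nonnegative terms.
\<close>

lemma state_op_inj:
  assumes h: "Im h > 0"
  shows "inj_on (\<lambda>y. \<lambda>v\<in>D_star q l. state_op q l \<mu> h y v - (- \<i>) * L2_inner l y v) (D_star q l)"
proof (rule inj_onI)
  fix y y' assume y: "y \<in> D_star q l" and y': "y' \<in> D_star q l"
    and eq: "(\<lambda>v\<in>D_star q l. state_op q l \<mu> h y v - (- \<i>) * L2_inner l y v) =
             (\<lambda>v\<in>D_star q l. state_op q l \<mu> h y' v - (- \<i>) * L2_inner l y' v)"
  define w where "w = (\<lambda>x. 1 * y x + (-1) * y' x)"
  have w: "w \<in> D_star q l" unfolding w_def using y y' by (rule D_star_lincomb)
  have wl: "w l = y l - y' l" by (simp add: w_def)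
  have Dw: "D l w l = D l y l - D l y' l"
    using D_star_lincomb(2)[OF y y', where a = 1 and b = "-1"] by (simp add: w_def)
  have sw: "L2_inner l (schr q l w) w = L2_inner l (schr q l y) w - L2_inner l (schr q l y') w"
    using D_star_lincomb(3)[OF y y' D_star_L2[OF w], where a = 1 and b = "-1"] by (simp add: w_def)
  have ww: "L2_inner l w w = L2_inner l y w - L2_inner l y' w"
    using L2_inner_lincomb_left[OF D_star_L2[OF y] D_star_L2[OF y'] D_star_L2[OF w], of 1 "-1"]
    by (simp add: w_def)
  define K where "K = (case \<mu> of
        Some m \<Rightarrow> 1 / (complex_of_real m - h) * (D l w l - h * w l) * (complex_of_real m * cnj (w l) - cnj (D l w l))
      | None \<Rightarrow> (D l w l - h * w l) * cnj (w l))"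
  have "L2_inner l (schr q l w) w - K + \<i> * L2_inner l w w = 0"
    using fun_cong[OF eq, of w] w
    by (cases \<mu>) (simp_all add: K_def state_op_def delta_def delta'_def sw ww wl Dw algebra_simps diff_divide_distrib add_divide_distrib)
  moreover have "L2_inner l (schr q l w) w = boundary_form q l w w + D l w l * cnj (w l)"
    by (simp add: boundary_form_def)
  ultimately have "boundary_form q l w w + (D l w l * cnj (w l) - K) + \<i> * L2_inner l w w = 0"
    by (simp add: algebra_simps)
  then have "Im (boundary_form q l w w) + Im (D l w l * cnj (w l) - K) + Re (L2_inner l w w) = 0"
    by (metis (no_types, lifting) Im_i_times plus_complex.simps(2) zero_complex.simps(2))
  moreover have "Im (boundary_form q l w w) = 0"
    using boundary_form_real[OF w] by (metis Im_complex_of_real)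
  moreover have "0 \<le> Im (D l w l * cnj (w l) - K)"
    unfolding K_def using h by (rule coupled_form_Im_nonneg)
  ultimately have "L2_inner l w w = 0"
    using L2_inner_self_nonneg[of l w] L2_inner_self_Im[of l w] by (simp add: complex_eq_iff)
  then have "w x = 0" if "l \<le> x" for x
    using L2_inner_self_eq_0[OF D_star_L2[OF w] twice_AC_continuous[OF D_star_AC[OF w]] _ that] by simp
  then have "y x = y' x" if "l \<le> x" for x
    using that by (simp add: w_def)
  moreover have "y x = y' x" if "x < l" for x
    using D_star_left[OF y that] D_star_left[OF y' that] by simp
  ultimately show "y = y'" by (metis ext not_le)
qed

end

lemma transfer_algebra:
  fixes h k :: complex and \<mu> :: real
  assumes h: "Im h > 0" and k: "Im k > 0"
  defines "s \<equiv> complex_of_real (sqrt (Im h) / cmod (\<mu> - h))"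
  shows "cmod (1 - 2 * \<i> * (s * (s * (\<mu> - h) / (k + h) * (\<mu> + k)))) = cmod (k + cnj h) / cmod (k + h)"
proof -
  have ne: "\<mu> - h \<noteq> 0" "\<mu> - cnj h \<noteq> 0" "k + h \<noteq> 0"
    using h k by (auto simp: complex_eq_iff)
  have "s * s = complex_of_real (Im h) / complex_of_real ((cmod (\<mu> - h))\<^sup>2)"
    using h of_real_sqrt_square[of "Im h"] by (simp add: s_def power2_eq_square)
  also have "complex_of_real ((cmod (\<mu> - h))\<^sup>2) = (\<mu> - h) * cnj (\<mu> - h)"
    by (simp only: complex_norm_square)
  finally have ss: "s * s * (\<mu> - h) = complex_of_real (Im h) / (\<mu> - cnj h)"
    using ne by simp
  have Imh: "2 * \<i> * complex_of_real (Im h) = h - cnj h"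
    by (simp add: complex_eq_iff)
  let ?Q = "(\<mu> - cnj h) * (k + h)"
  have "1 - 2 * \<i> * (s * (s * (\<mu> - h) / (k + h) * (\<mu> + k)))
      = 1 - 2 * \<i> * (s * s * (\<mu> - h)) * (\<mu> + k) / (k + h)" by simp
  also have "\<dots> = 1 - (2 * \<i> * complex_of_real (Im h)) * (\<mu> + k) / ?Q"
    unfolding ss by simp
  also have "\<dots> = (?Q - (h - cnj h) * (\<mu> + k)) / ?Q"
    unfolding Imh using ne by (simp add: diff_divide_distrib)
  also have "?Q - (h - cnj h) * (\<mu> + k) = (\<mu> - h) * (k + cnj h)"
    by (simp add: algebra_simps)
  finally have "cmod (1 - 2 * \<i> * (s * (s * (\<mu> - h) / (k + h) * (\<mu> + k))))
      = cmod (\<mu> - h) * cmod (k + cnj h) / (cmod (\<mu> - cnj h) * cmod (k + h))"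
    by (simp add: norm_mult norm_divide)
  moreover have "cmod (\<mu> - cnj h) = cmod (\<mu> - h)"
    using complex_mod_cnj[of "\<mu> - h"] by simp
  ultimately show ?thesis using ne by simp
qed

context weyl_schroedinger
begin

text \<open>
  Every element of \<open>D\<^sup>*\<close> with \<open>l(y) = -\<i> y\<close> is mapped by \<open>\<A> + \<i>\<close> to a multiple of the channel vector. A suitable
  multiple \<open>C \<psi>\<close> of the Weyl solution at \<open>-\<i>\<close> therefore is the resolvent applied to the channel vector.
\<close>

lemma cmod_transfer_function:
  assumes h: "Im h > 0"
  shows "cmod (transfer_function q l \<mu> h (- \<i>)) = cmod (cnj (M \<i>) + cnj h) / cmod (cnj (M \<i>) + h)"
proof -
  define k where "k = cnj (M \<i>)"
  have k: "Im k > 0" using M_Im_neg by (simp add: k_def)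
  have ne: "k + h \<noteq> 0" using k h by (auto simp: complex_eq_iff)
  obtain \<psi> where \<psi>: "\<psi> \<in> D_star q l" "\<psi> l = -1" "D l \<psi> l = k"
    "\<And>f. f \<in> L2 l \<Longrightarrow> L2_inner l (schr q l \<psi>) f = - \<i> * L2_inner l \<psi> f"
    using weyl_solution[OF weyl, of "- \<i>"] by (auto simp: complex_nonneg_Reals_iff M_cnj k_def)
  define C where "C = (case \<mu> of
      Some m \<Rightarrow> - (complex_of_real (sqrt (Im h) / cmod (m - h)) * (m - h) / (k + h))
    | None \<Rightarrow> - (complex_of_real (sqrt (Im h)) / (k + h)))"
  define y where "y = (\<lambda>x. C * \<psi> x + 0 * \<psi> x)"
  have y: "y \<in> D_star q l" unfolding y_def using \<psi>(1,1) by (rule D_star_lincomb)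
  have yl: "y l = - C" by (simp add: y_def \<psi>(2))
  have Dy: "D l y l = C * k"
    using D_star_lincomb(2)[OF \<psi>(1,1), where a = C and b = 0] \<psi>(3) by (simp add: y_def)
  have sy: "L2_inner l (schr q l y) v = - \<i> * L2_inner l y v" if v: "v \<in> D_star q l" for v
    using D_star_lincomb(3)[OF \<psi>(1,1) D_star_L2[OF v], where a = C and b = 0] \<psi>(4)[OF D_star_L2[OF v]]
      L2_inner_lincomb_left[OF D_star_L2[OF \<psi>(1)] D_star_L2[OF \<psi>(1)] D_star_L2[OF v], of C 0]
    by (simp add: y_def)
  let ?F = "\<lambda>y. \<lambda>v\<in>D_star q l. state_op q l \<mu> h y v - (- \<i>) * L2_inner l y v"
  have "?F y v = K_op q l \<mu> h 1 v" for v
  proof (cases "v \<in> D_star q l")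
    case True
    show ?thesis
    proof (cases \<mu>)
      case None
      have "D l y l - h * y l = C * (k + h)" by (simp add: yl Dy algebra_simps)
      also have "\<dots> = - complex_of_real (sqrt (Im h))"
        using ne by (simp add: C_def None)
      finally show ?thesis
        using True None by (simp add: state_op_def K_op_def channel_vec_def sy)
    next
      case (Some m)
      have "complex_of_real m - h \<noteq> 0" using h by (auto simp: complex_eq_iff)
      have "D l y l - h * y l = C * (k + h)" by (simp add: yl Dy algebra_simps)
      also have "\<dots> = - (complex_of_real (sqrt (Im h) / cmod (m - h)) * (m - h))"
        using ne by (simp add: C_def Some)
      finally have "1 / (complex_of_real m - h) * (D l y l - h * y l) = - complex_of_real (sqrt (Im h) / cmod (m - h))"
        using \<open>complex_of_real m - h \<noteq> 0\<close> by simp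
      then show ?thesis
        using True Some by (simp add: state_op_def K_op_def channel_vec_def sy)
    qed
  qed (simp add: K_op_def)
  then have "?F y = K_op q l \<mu> h 1" by (rule ext)
  then have "state_resolvent q l \<mu> h (- \<i>) (K_op q l \<mu> h 1) = y"
    unfolding state_resolvent_def by (rule inv_into_f_eq[OF state_op_inj[OF h] y])
  then have W: "transfer_function q l \<mu> h (- \<i>) = 1 - 2 * \<i> * cnj (channel_vec q l \<mu> h y)"
    by (simp add: transfer_function_def K_adj_def)
  show ?thesis
  proof (cases \<mu>)
    case None
    have "cnj (channel_vec q l \<mu> h y) = complex_of_real (Im h) / (k + h)"
      using y None h of_real_sqrt_square[of "Im h"] by (simp add: channel_vec_def delta_def yl C_def)
    then have "transfer_function q l \<mu> h (- \<i>) = 1 - 2 * \<i> * complex_of_real (Im h) / (k + h)"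
      using W by simp
    also have "2 * \<i> * complex_of_real (Im h) = h - cnj h"
      by (simp add: complex_eq_iff)
    also have "1 - (h - cnj h) / (k + h) = (k + cnj h) / (k + h)"
      using ne by (simp add: divide_simps)
    finally show ?thesis by (simp add: norm_divide k_def)
  next
    case (Some m)
    define s where "s = complex_of_real (sqrt (Im h) / cmod (m - h))"
    have "cnj (channel_vec q l \<mu> h y) = s * (m * y l - D l y l)"
      using y Some by (simp add: channel_vec_def delta_def delta'_def s_def)
    also have "\<dots> = s * (- C * (m + k))" by (simp add: yl Dy algebra_simps)
    also have "- C = s * (m - h) / (k + h)" by (simp add: C_def Some s_def)
    finally have "cmod (transfer_function q l \<mu> h (- \<i>)) = cmod (k + cnj h) / cmod (k + h)"
      unfolding W s_def by (simp only: transfer_algebra[OF h k])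
    then show ?thesis by (simp add: k_def)
  qed
qed

end

section \<open>Accretive and extremal boundary conditions\<close>

locale weyl_schroedinger_limit = weyl_schroedinger +
  fixes m :: real
  assumes M_limit: "((\<lambda>t. M (complex_of_real t)) \<longlongrightarrow> complex_of_real m) (at_left 0)"
begin

lemma boundary_form_lower_bound:
  assumes y: "y \<in> D_star q l"
  shows "m * (cmod (y l))\<^sup>2 \<le> Re (boundary_form q l y y)"
proof -
  let ?f = "\<lambda>t. (cmod (y l))\<^sup>2 * Re (M (complex_of_real t)) + t * Re (L2_inner l y y)"
  have "(?f \<longlongrightarrow> (cmod (y l))\<^sup>2 * Re (complex_of_real m) + 0 * Re (L2_inner l y y)) (at_left 0)"
    by (intro tendsto_intros M_limit)
  then have "(?f \<longlongrightarrow> m * (cmod (y l))\<^sup>2) (at_left 0)"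
    by (simp add: mult.commute)
  moreover have "eventually (\<lambda>t. ?f t \<le> Re (boundary_form q l y y)) (at_left 0)"
    unfolding eventually_at_filter
    by (intro always_eventually allI impI boundary_form_lower_bound_negative y) auto
  ultimately show ?thesis
    by (rule tendsto_upperbound) simp
qed

text \<open>
  The Weyl solution \<open>\<psi>\<close> at \<open>t < 0\<close> close to \<open>0\<close> has energy \<open>M(t) + t \<parallel>\<psi>\<parallel>\<^sup>2 \<le> M(t)\<close>; its slope is then
  adjusted to the boundary condition by a concentrated function.
\<close>

lemma boundary_form_approximation:
  assumes \<delta>: "0 < \<delta>"
  obtains y where "y \<in> dom_T q l h" "y l = -1" "Re (boundary_form q l y y) \<le> m + \<delta>"
proof -
  have "((\<lambda>t. Re (M (complex_of_real t))) \<longlongrightarrow> Re (complex_of_real m)) (at_left 0)"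
    by (intro tendsto_intros M_limit)
  then have "eventually (\<lambda>t. Re (M (complex_of_real t)) < m + \<delta> \<and> t < 0) (at_left 0)"
    using \<delta> order_tendstoD(2)[of "\<lambda>t. Re (M (complex_of_real t))" m "at_left 0" "m + \<delta>"]
    by (intro eventually_conj) (auto simp: eventually_at_filter)
  then obtain t :: real where t: "Re (M (complex_of_real t)) < m + \<delta>" "t < 0"
    using eventually_happens'[OF trivial_limit_at_left_real] by blast
  obtain \<psi> where \<psi>: "\<psi> \<in> D_star q l" "\<psi> l = -1" "D l \<psi> l = M t"
    "\<And>f. f \<in> L2 l \<Longrightarrow> L2_inner l (schr q l \<psi>) f = complex_of_real t * L2_inner l \<psi> f"
    using weyl_solution[OF weyl, of "complex_of_real t"] t by (auto simp: complex_nonneg_Reals_iff)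
  have "Re (boundary_form q l \<psi> \<psi>) = t * Re (L2_inner l \<psi> \<psi>) + Re (M t)"
    using \<psi> D_star_L2[OF \<psi>(1)] by (simp add: boundary_form_def)
  also have "\<dots> < m + \<delta>"
    using t L2_inner_self_nonneg[of l \<psi>] mult_nonpos_nonneg[of t "Re (L2_inner l \<psi> \<psi>)"] by simp
  finally have less: "Re (boundary_form q l \<psi> \<psi>) < m + \<delta>" .
  obtain u where u: "u \<in> D_star q l" "u l = 0" "D l u l = 1" by (rule D_star_unit_slope)
  obtain w where w: "\<And>n. w n \<in> D_star q l" "\<And>n. w n l = 0" "\<And>n. D l (w n) l = 1"
    "\<And>f. f \<in> L2 l \<Longrightarrow> (\<lambda>n. L2_inner l f (w n)) \<longlonglongrightarrow> 0"
    "(\<lambda>n. L2_inner l (schr q l (w n)) (w n)) \<longlonglongrightarrow> 0"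
    by (rule concentrated_functions[OF u], rule that) blast+
  define c where "c = - h - M t"
  have "eventually (\<lambda>n. Re (boundary_form q l (\<lambda>x. 1 * \<psi> x + c * w n x) (\<lambda>x. 1 * \<psi> x + c * w n x)) < m + \<delta>) sequentially"
    using boundary_form_perturb_tendsto[OF \<psi>(1) w(1,2,4,5)] less by (rule order_tendstoD)
  then obtain n where n: "Re (boundary_form q l (\<lambda>x. 1 * \<psi> x + c * w n x) (\<lambda>x. 1 * \<psi> x + c * w n x)) < m + \<delta>"
    using eventually_happens'[OF sequentially_bot] by blast
  show ?thesis
  proof (rule that)
    show "(\<lambda>x. 1 * \<psi> x + c * w n x) \<in> dom_T q l h"
      using D_star_lincomb(1,2)[OF \<psi>(1) w(1), where a = 1 and b = c] \<psi>(2,3) w(2,3)[of n]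
      by (simp add: dom_T_def c_def)
    show "1 * \<psi> l + c * w n l = - 1" using \<psi>(2) w(2) by simp
  qed (use n in simp)
qed

lemma dom_T_form:
  assumes "y \<in> dom_T q l h"
  shows "Re (L2_inner l (schr q l y) y) = Re (boundary_form q l y y) + Re h * (cmod (y l))\<^sup>2"
    and "Im (L2_inner l (schr q l y) y) = Im h * (cmod (y l))\<^sup>2"
proof -
  have y: "y \<in> D_star q l" and Dy: "D l y l = h * y l" using assms by (auto simp: dom_T_def)
  have "L2_inner l (schr q l y) y = boundary_form q l y y + h * (y l * cnj (y l))"
    by (simp add: boundary_form_def Dy)
  also have "y l * cnj (y l) = complex_of_real ((cmod (y l))\<^sup>2)" by (simp only: complex_norm_square)
  finally have eq: "L2_inner l (schr q l y) y = boundary_form q l y y + h * complex_of_real ((cmod (y l))\<^sup>2)" .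
  show "Re (L2_inner l (schr q l y) y) = Re (boundary_form q l y y) + Re h * (cmod (y l))\<^sup>2"
    unfolding eq by simp
  have "Im (boundary_form q l y y) = 0"
    using boundary_form_real[OF y] by (metis Im_complex_of_real)
  then show "Im (L2_inner l (schr q l y) y) = Im h * (cmod (y l))\<^sup>2"
    unfolding eq by simp
qed

lemma accretive_iff: "accretive l (dom_T q l h) (schr q l) \<longleftrightarrow> - m \<le> Re h"
proof
  assume acc: "accretive l (dom_T q l h) (schr q l)"
  have "- Re h \<le> m + \<delta>" if \<delta>: "0 < \<delta>" for \<delta>
  proof -
    obtain y where y: "y \<in> dom_T q l h" "y l = -1" "Re (boundary_form q l y y) \<le> m + \<delta>"
      using \<delta> by (rule boundary_form_approximation)
    have "0 \<le> Re (L2_inner l (schr q l y) y)" using acc y(1) by (auto simp: accretive_def)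
    then show ?thesis using dom_T_form(1)[OF y(1)] y(2,3) by simp
  qed
  then have "- Re h \<le> m" by (rule field_le_epsilon)
  then show "- m \<le> Re h" by simp
next
  assume h: "- m \<le> Re h"
  show "accretive l (dom_T q l h) (schr q l)"
    unfolding accretive_def
  proof
    fix y assume y: "y \<in> dom_T q l h"
    have "0 \<le> (m + Re h) * (cmod (y l))\<^sup>2" using h by simp
    then show "0 \<le> Re (L2_inner l (schr q l y) y)"
      using dom_T_form(1)[OF y] boundary_form_lower_bound[of y] y
      by (simp add: dom_T_def algebra_simps)
  qed
qed

lemma extremal_boundary:
  assumes h: "Re h = - m" "Im h > 0"
  shows "extremal_accretive l (dom_T q l h) (schr q l)"
  unfolding extremal_accretive_def
proof (intro conjI notI)
  show "accretive l (dom_T q l h) (schr q l)" using h by (simp add: accretive_iff)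
  assume "\<exists>\<alpha>. 0 < \<alpha> \<and> \<alpha> < pi / 2 \<and> sectorial l \<alpha> (dom_T q l h) (schr q l)"
  then obtain \<alpha> where \<alpha>: "0 < \<alpha>" "\<alpha> < pi / 2" and sec: "sectorial l \<alpha> (dom_T q l h) (schr q l)"
    by blast
  have "0 < cot \<alpha>" using \<alpha> cot_gt_zero by simp
  then have pos: "0 < cot \<alpha> * Im h / 2" using h(2) by simp
  obtain y where y: "y \<in> dom_T q l h" "y l = -1" "Re (boundary_form q l y y) \<le> m + cot \<alpha> * Im h / 2"
    using pos by (rule boundary_form_approximation)
  have "cot \<alpha> * \<bar>Im (L2_inner l (schr q l y) y)\<bar> \<le> Re (L2_inner l (schr q l y) y)"
    using sec y(1) by (auto simp: sectorial_def)
  then have "cot \<alpha> * Im h \<le> Re (boundary_form q l y y) - m"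
    using dom_T_form[OF y(1)] y(2) h by simp
  then show False using pos y(3) by linarith
qed

text \<open>
  Let \<open>\<psi>\<close> be the Weyl solution at \<open>\<i>\<close>, \<open>\<chi>\<close> a cutoff and \<open>v = (1 - \<chi>) \<psi>\<close>. Then \<open>Q(\<psi>, \<psi>) = Re (M \<i>)\<close>, and
  \<open>Q(\<psi>, v) = \<i> (\<psi>, v)\<close> is a nonzero imaginary number. So \<open>\<psi> - \<i> r v\<close>, which has the same value at \<open>l\<close> as
  \<open>\<psi>\<close>, has smaller energy for small \<open>r > 0\<close>, and this energy is still at least \<open>m\<close>.
\<close>

lemma limit_less_Re_M: "m < Re (M \<i>)"
proof -
  obtain \<psi> where \<psi>: "\<psi> \<in> D_star q l" "\<psi> l = -1" "D l \<psi> l = M \<i>"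
    "\<And>f. f \<in> L2 l \<Longrightarrow> L2_inner l (schr q l \<psi>) f = \<i> * L2_inner l \<psi> f"
    using weyl_solution[OF weyl, of \<i>] by (auto simp: complex_nonneg_Reals_iff)
  note AC = D_star_AC[OF \<psi>(1)]
  have form: "Re (boundary_form q l \<psi> \<psi>) = Re (M \<i>)"
    using \<psi>(4)[OF D_star_L2[OF \<psi>(1)]] \<psi>(2,3) L2_inner_self_Im[of l \<psi>] by (simp add: boundary_form_def)
  define v where "v = (\<lambda>x. 1 * \<psi> x + (-1) * (complex_of_real (cutoff l 1 x) * \<psi> x))"
  have v_min: "v \<in> dom_min q l" unfolding v_def using \<psi>(1) by (rule cutoff_remainder_dom_min) simp
  then have v: "v \<in> D_star q l" "v l = 0" by (auto simp: dom_min_def)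
  define N where "N = (\<integral>x. (1 - cutoff l 1 x) * (cmod (\<psi> x))\<^sup>2 \<partial>lebesgue_on {l..})"
  have "L2_inner l \<psi> v = (\<integral>x. complex_of_real ((1 - cutoff l 1 x) * (cmod (\<psi> x))\<^sup>2) \<partial>lebesgue_on {l..})"
    unfolding L2_inner_def
  proof (rule Bochner_Integration.integral_cong)
    fix x
    have "\<psi> x * cnj (v x) = complex_of_real (1 - cutoff l 1 x) * (\<psi> x * cnj (\<psi> x))"
      by (simp add: v_def algebra_simps)
    also have "\<dots> = complex_of_real ((1 - cutoff l 1 x) * (cmod (\<psi> x))\<^sup>2)"
      by (simp only: complex_norm_square[symmetric] of_real_mult)
    finally show "\<psi> x * cnj (v x) = complex_of_real ((1 - cutoff l 1 x) * (cmod (\<psi> x))\<^sup>2)" .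
  qed simp
  then have N: "L2_inner l \<psi> v = complex_of_real N" by (simp only: N_def integral_complex_of_real)
  have int: "integrable (lebesgue_on {l..}) (\<lambda>x. (1 - cutoff l 1 x) * (cmod (\<psi> x))\<^sup>2)"
  proof (rule Bochner_Integration.integrable_bound[OF L2_integrable[OF D_star_L2[OF \<psi>(1)]]])
    show "(\<lambda>x. (1 - cutoff l 1 x) * (cmod (\<psi> x))\<^sup>2) \<in> borel_measurable (lebesgue_on {l..})"
      by (intro continuous_imp_measurable_on_sets_lebesgue continuous_intros twice_AC_continuous[OF AC])
        (auto simp: cutoff_def intro!: continuous_intros)
    show "AE x in lebesgue_on {l..}. norm ((1 - cutoff l 1 x) * (cmod (\<psi> x))\<^sup>2) \<le> norm ((cmod (\<psi> x))\<^sup>2)"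
      by (rule AE_I2) (simp add: abs_mult cutoff_nonneg cutoff_le_1 mult_left_le_one_le)
  qed
  have "N \<noteq> 0"
  proof
    assume "N = 0"
    then have "AE x in lebesgue_on {l..}. (1 - cutoff l 1 x) * (cmod (\<psi> x))\<^sup>2 = 0"
      using int unfolding N_def
      by (subst (asm) integral_nonneg_eq_0_iff_AE) (auto simp: cutoff_le_1)
    moreover have "AE x in lebesgue_on {l..}. x \<noteq> l"
      by (rule AE_lebesgue_on_negligible[of "{l}"]) auto
    ultimately have "AE x in lebesgue_on {l..}. \<psi> x = 0"
      using AE_half_line_in[of l]
    proof eventually_elim
      case (elim x)
      then show ?case using cutoff_less_1[of 1 l x] by auto
    qed
    from AE_half_line_continuous_zero[OF twice_AC_continuous[OF AC] this, of l] show False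
      using \<psi>(2) by simp
  qed
  moreover have "0 \<le> N" unfolding N_def
    by (rule Bochner_Integration.integral_nonneg) (simp add: cutoff_le_1)
  ultimately have N_pos: "0 < N" by simp
  have "boundary_form q l \<psi> v = \<i> * N"
    using \<psi>(4)[OF D_star_L2[OF v(1)]] N v(2) by (simp add: boundary_form_def)
  then have *: "m \<le> Re (M \<i>) - 2 * r * N + r\<^sup>2 * Re (boundary_form q l v v)" for r :: real
    using boundary_form_expand[OF \<psi>(1) v(1), of "- \<i> * r"]
      boundary_form_lower_bound[OF D_star_lincomb(1)[OF \<psi>(1) v(1)], of 1 "- \<i> * r"] form \<psi>(2) v(2)
    by (simp add: norm_mult)
  define Q where "Q = Re (boundary_form q l v v)"
  have Q: "0 \<le> Q" unfolding Q_def using v_min by (rule boundary_form_dom_min)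
  \<comment> \<open>any \<open>r > 0\<close> with \<open>r Q < 2 N\<close> works; \<open>Q + 1\<close> avoids a division by zero\<close>
  define r where "r = N / (Q + 1)"
  have r: "0 < r" using N_pos Q by (simp add: r_def)
  have "r * Q < N" using N_pos Q by (simp add: r_def field_simps)
  then have "r\<^sup>2 * Q < r * N" using r by (simp add: power2_eq_square)
  then have "r\<^sup>2 * Q < 2 * r * N" using mult_pos_pos[OF r N_pos] by simp
  then show ?thesis using *[of r] by (simp add: Q_def)
qed

end

section \<open>Maximization of the c-entropy\<close>

text \<open>
  After multiplication by the denominators the difference of the two sides is
  \<open>2 B ((y - R)\<^sup>2 + (s\<^sup>2 - d\<^sup>2))\<close>.
\<close>

lemma ratio_minimum:
  fixes B R d s y :: real
  assumes B: "B > 0" and d: "d > 0" and R: "R = sqrt (d\<^sup>2 + B\<^sup>2)" and s: "d \<le> s" and y: "y > 0"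
  shows "(R - B) / (R + B) \<le> (s\<^sup>2 + (B - y)\<^sup>2) / (s\<^sup>2 + (B + y)\<^sup>2)"
    and "(s\<^sup>2 + (B - y)\<^sup>2) / (s\<^sup>2 + (B + y)\<^sup>2) = (R - B) / (R + B) \<longleftrightarrow> s = d \<and> y = R"
proof -
  have R2: "R\<^sup>2 = d\<^sup>2 + B\<^sup>2" unfolding R by simp
  have R_pos: "R + B > 0" using B R2 unfolding R by (simp add: add_nonneg_pos)
  have den: "s\<^sup>2 + (B + y)\<^sup>2 > 0" using B y by (simp add: add_nonneg_pos)
  have s2: "0 \<le> s\<^sup>2 - d\<^sup>2" using power_mono[OF s, of 2] d by simp
  have diff: "(R + B) * (s\<^sup>2 + (B - y)\<^sup>2) - (R - B) * (s\<^sup>2 + (B + y)\<^sup>2)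
      = 2 * B * ((y - R)\<^sup>2 + (s\<^sup>2 - d\<^sup>2))"
  proof -
    have "(R + B) * (s\<^sup>2 + (B - y)\<^sup>2) - (R - B) * (s\<^sup>2 + (B + y)\<^sup>2)
        = 2 * B * ((y - R)\<^sup>2 + (s\<^sup>2 - (R\<^sup>2 - B\<^sup>2)))"
      by (simp add: power2_eq_square algebra_simps)
    then show ?thesis using R2 by simp
  qed
  define P Q where "P = s\<^sup>2 + (B - y)\<^sup>2" and "Q = s\<^sup>2 + (B + y)\<^sup>2"
  note diff = diff[folded P_def Q_def]
  have Q: "Q > 0" using den by (simp add: Q_def)
  have "0 \<le> 2 * B * ((y - R)\<^sup>2 + (s\<^sup>2 - d\<^sup>2))" using B s2 by simp
  then have "(R - B) * Q \<le> P * (R + B)"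
    unfolding diff[symmetric] by (simp add: mult.commute)
  then show "(R - B) / (R + B) \<le> (s\<^sup>2 + (B - y)\<^sup>2) / (s\<^sup>2 + (B + y)\<^sup>2)"
    unfolding P_def[symmetric] Q_def[symmetric] using R_pos Q
    by (simp add: pos_divide_le_eq pos_le_divide_eq)
  have "P / Q = (R - B) / (R + B) \<longleftrightarrow> (R + B) * P - (R - B) * Q = 0"
    using R_pos Q by (simp add: frac_eq_eq mult.commute)
  also have "\<dots> \<longleftrightarrow> (y - R)\<^sup>2 + (s\<^sup>2 - d\<^sup>2) = 0"
    unfolding diff using B by simp
  also have "\<dots> \<longleftrightarrow> (y - R)\<^sup>2 = 0 \<and> s\<^sup>2 - d\<^sup>2 = 0"
    using s2 by (simp add: add_nonneg_eq_0_iff)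
  also have "\<dots> \<longleftrightarrow> s = d \<and> y = R"
    using d s by (auto simp: power2_eq_iff)
  finally show "(s\<^sup>2 + (B - y)\<^sup>2) / (s\<^sup>2 + (B + y)\<^sup>2) = (R - B) / (R + B) \<longleftrightarrow> s = d \<and> y = R"
    unfolding P_def Q_def .
qed

lemma (in weyl_schroedinger) c_entropy_eq:
  assumes h: "Im h > 0" and r: "r = ((Re (M \<i>) + Re h)\<^sup>2 + (- Im (M \<i>) - Im h)\<^sup>2) /
      ((Re (M \<i>) + Re h)\<^sup>2 + (- Im (M \<i>) + Im h)\<^sup>2)" and pos: "0 < r"
  shows "c_entropy q l \<mu> h = ereal (- (1 / 2) * ln r)"
proof -
  define W where "W = transfer_function q l \<mu> h (- \<i>)"
  have "(cmod W)\<^sup>2 = r"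
    unfolding W_def cmod_transfer_function[OF h] r by (simp add: power_divide cmod_power2)
  then have "cmod W > 0" "ln r = 2 * ln (cmod W)"
    using pos by (auto simp: ln_realpow)
  then show ?thesis by (auto simp: c_entropy_def W_def[symmetric] Let_def)
qed

theorem theorem29:
  fixes q :: "real \<Rightarrow> real" and l m A B S\<^sub>m\<^sub>a\<^sub>x :: real
    and M :: "complex \<Rightarrow> complex" and h\<^sub>0 :: complex
  assumes "locally_summable l q"
    and "deficiency_index q l \<i> = 1" and "deficiency_index q l (- \<i>) = 1"
    and "nonnegative_op l (dom_min q l) (schr q l)"
    and "weyl_function q l M"
    and "((\<lambda>t. M (complex_of_real t)) \<longlongrightarrow> complex_of_real m) (at_left 0)"
    and "A = Re (M \<i>)" and "B = - Im (M \<i>)"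
    and "S\<^sub>m\<^sub>a\<^sub>x = - (1 / 2) * ln ((sqrt (A\<^sup>2 + B\<^sup>2 - 2 * m * A + m\<^sup>2) - B) /
                               (sqrt (A\<^sup>2 + B\<^sup>2 - 2 * m * A + m\<^sup>2) + B))"
    and "h\<^sub>0 = - complex_of_real m + \<i> * complex_of_real (sqrt ((A - m)\<^sup>2 + B\<^sup>2))"
  shows "Im h\<^sub>0 > 0 \<and> extremal_accretive l (dom_T q l h\<^sub>0) (schr q l) \<and>
         (\<forall>\<mu>. c_entropy q l \<mu> h\<^sub>0 = ereal S\<^sub>m\<^sub>a\<^sub>x) \<and>
         (\<forall>\<mu> h. Im h > 0 \<and> accretive l (dom_T q l h) (schr q l) \<longrightarrow>
            c_entropy q l \<mu> h \<le> ereal S\<^sub>m\<^sub>a\<^sub>x \<and>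
            (c_entropy q l \<mu> h = ereal S\<^sub>m\<^sub>a\<^sub>x \<longrightarrow> h = h\<^sub>0))"
proof -
  interpret weyl_schroedinger_limit q l M m
    using assms(4,5,6) by unfold_locales
  define R where "R = sqrt ((A - m)\<^sup>2 + B\<^sup>2)"
  have B: "B > 0" using M_Im_neg assms(8) by simp
  have d: "A - m > 0" using limit_less_Re_M assms(7) by simp
  have R_less: "B < R"
    unfolding R_def using d by (intro real_less_rsqrt) simp
  have "A\<^sup>2 + B\<^sup>2 - 2 * m * A + m\<^sup>2 = (A - m)\<^sup>2 + B\<^sup>2"
    by (simp add: power2_eq_square algebra_simps)
  then have S: "S\<^sub>m\<^sub>a\<^sub>x = - (1 / 2) * ln ((R - B) / (R + B))"
    by (simp only: assms(9) R_def)
  have h0: "Re h\<^sub>0 = - m" "Im h\<^sub>0 = R"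
    using assms(10) by (simp_all add: R_def)
  define r where "r = (\<lambda>h. ((A + Re h)\<^sup>2 + (B - Im h)\<^sup>2) / ((A + Re h)\<^sup>2 + (B + Im h)\<^sup>2))"
  have frac_pos: "0 < (R - B) / (R + B)" using R_less B by simp
  have main: "(R - B) / (R + B) \<le> r h" "r h = (R - B) / (R + B) \<longleftrightarrow> h = h\<^sub>0"
    "c_entropy q l \<mu> h = ereal (- (1 / 2) * ln (r h))" if "Im h > 0" "- m \<le> Re h" for h \<mu>
  proof -
    have s: "A - m \<le> A + Re h" using that by simp
    note * = ratio_minimum[OF B d R_def s that(1), folded r_def]
    show "(R - B) / (R + B) \<le> r h" using *(1) by (simp add: r_def)
    show "r h = (R - B) / (R + B) \<longleftrightarrow> h = h\<^sub>0"
      using *(2) h0 by (auto simp: r_def complex_eq_iff)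
    have "0 < r h" using *(1) frac_pos by (simp add: r_def)
    then show "c_entropy q l \<mu> h = ereal (- (1 / 2) * ln (r h))"
      by (intro c_entropy_eq that) (simp_all add: r_def assms(7,8))
  qed
  have R_pos: "R > 0" using R_less B by simp
  show ?thesis
  proof (intro conjI allI impI)
    show "Im h\<^sub>0 > 0" using h0 R_pos by simp
    show "extremal_accretive l (dom_T q l h\<^sub>0) (schr q l)"
      using h0 R_pos by (intro extremal_boundary) auto
    show "c_entropy q l \<mu> h\<^sub>0 = ereal S\<^sub>m\<^sub>a\<^sub>x" for \<mu>
      using main(2)[of "h\<^sub>0"] main(3)[of "h\<^sub>0" \<mu>] h0 R_pos by (simp add: S)
  next
    fix \<mu> h assume "Im h > 0 \<and> accretive l (dom_T q l h) (schr q l)"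
    then have h: "Im h > 0" "- m \<le> Re h" by (auto simp: accretive_iff)
    have r: "0 < r h" using main(1)[OF h] frac_pos by linarith
    show "c_entropy q l \<mu> h \<le> ereal S\<^sub>m\<^sub>a\<^sub>x"
      using main(1)[OF h] frac_pos r unfolding main(3)[OF h] S by simp
    assume "c_entropy q l \<mu> h = ereal S\<^sub>m\<^sub>a\<^sub>x"
    then have "ln (r h) = ln ((R - B) / (R + B))"
      unfolding main(3)[OF h] S by simp
    then have "r h = (R - B) / (R + B)" using r frac_pos by (simp only: ln_inj_iff)
    then show "h = h\<^sub>0" using main(2)[OF h] by simp
  qed
qed

end
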